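(* Let $n\ge 1$, let $V$ be a complex vector space with basis $x_1,\dots,x_n$, and let $S_{-\mathbf 1}(V)=\mathbb C\langle x_1,\dots,x_n\mid x_ix_j=-x_jx_i\ (i\neq j)\rangle$. Let $\mathcal C'\subset\mathcal C$ be finite subgroups of $\mathbb C^\times$ with $-1\in\mathcal C$, and let $c\colon\mathcal C'\to\mathbb C$, $\varepsilon'\mapsto c_{\varepsilon'}$, be any function. For $i=1,\dots,n$ define the operator on the skew-field of fractions of $S_{-\mathbf 1}(V)$ $$\underline\nabla_i=\underline\partial_i+c_1\sum_{j\ne i,\ \varepsilon\in\mathcal C}\frac{x_i+\varepsilon x_j}{x_i^2-\varepsilon^2x_j^2}\,(1-\sigma_{ij}^{(\varepsilon)})+\sum_{\varepsilon'\in\mathcal C'\setminus\{1\}}\frac{c_{\varepsilon'}}{1-\varepsilon'}\cdot\frac1{x_i}\,(1-t_i^{(\varepsilon')}).$$ Then the operators $\underline\nabla_1,\dots,\underline\nabla_n$ preserve $S_{-\mathbf 1}(V)$ and satisfy $\underline\nabla_i\underline\nabla_j+\underline\nabla_j\underline\nabla_i=0$ for all $i\neq j$.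
   Context: $\underline\partial_i$ is the braided partial derivative: on $S_{-\mathbf 1}(V)$ it is the linear map $\underline\partial_i(x_1^{a_1}\cdots x_n^{a_n})=a_i(-1)^{a_1+\cdots+a_{i-1}}x_1^{a_1}\cdots x_i^{a_i-1}\cdots x_n^{a_n}$. It satisfies $\underline\partial_i(ab)=\underline\partial_i(a)b+\gamma_i(a)\underline\partial_i(b)$, where $\gamma_i$ is the algebra automorphism with $\gamma_i(x_i)=x_i$, $\gamma_i(x_j)=-x_j$ ($j\ne i$), and it is extended to the skew-field of fractions by this rule. For $\varepsilon\in\mathbb C^\times$ and $i\neq j$, $t_i^{(\varepsilon)}$ and $\sigma_{ij}^{(\varepsilon)}$ are the algebra automorphisms of $S_{-\mathbf 1}(V)$ (extended to its skew-field of fractions) given by: $t_i^{(\varepsilon)}(x_k)=x_k$ for $k\ne i$, $t_i^{(\varepsilon)}(x_i)=\varepsilon x_i$; $\sigma_{ij}^{(\varepsilon)}(x_k)=x_k$ for $k\notin\{i,j\}$, $\sigma_{ij}^{(\varepsilon)}(x_i)=\varepsilon x_j$, $\sigma_{ij}^{(\varepsilon)}(x_j)=-\varepsilon^{-1}x_i$. Elements of the skew-field (such as $\frac1{x_i}$ and $\frac{x_i+\varepsilon x_j}{x_i^2-\varepsilon^2x_j^2}$, where the denominator is central) act by left multiplication. *)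

theory Defs
  imports Complex_Main "HOL-Library.Poly_Mapping" "HOL-Algebra.Group"
begin

section \<open>The free algebra and its quotient \<open>S\<^sub>-\<^sub>1(V)\<close>\<close>

datatype 'n free_mon = FM (letters: "'n list")

instantiation free_mon :: (type) monoid_add
begin
definition zero_free_mon :: "'a free_mon" where "0 = FM []"
definition plus_free_mon :: "'a free_mon \<Rightarrow> 'a free_mon \<Rightarrow> 'a free_mon"
  where "u + v = FM (letters u @ letters v)"
instance
  by standard (simp_all add: zero_free_mon_def plus_free_mon_def)
end

lemma letters_simps [simp]: "letters 0 = []" "letters (u + v) = letters u @ letters v"
  by (simp_all add: zero_free_mon_def plus_free_mon_def)

text \<open>The type \<open>'n free_mon \<Rightarrow>\<^sub>0 complex\<close> is the monoid algebra of the free monoid, that is, the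
  free algebra on generators indexed by \<open>'n\<close>; its product is the convolution of \<open>Poly_Mapping\<close>.\<close>

type_synonym 'n free_alg = "'n free_mon \<Rightarrow>\<^sub>0 complex"

definition free_var :: "'n \<Rightarrow> 'n free_alg"
  where "free_var i = Poly_Mapping.single (FM [i]) 1"

definition free_const :: "complex \<Rightarrow> 'n free_alg"
  where "free_const c = Poly_Mapping.single 0 c"

inductive_set ideal_generated :: "'a::ring_1 set \<Rightarrow> 'a set" for G :: "'a set" where
  gen: "g \<in> G \<Longrightarrow> g \<in> ideal_generated G"
| zero: "0 \<in> ideal_generated G"
| add: "p \<in> ideal_generated G \<Longrightarrow> q \<in> ideal_generated G \<Longrightarrow> p + q \<in> ideal_generated G"
| lmult: "p \<in> ideal_generated G \<Longrightarrow> r * p \<in> ideal_generated G"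
| rmult: "p \<in> ideal_generated G \<Longrightarrow> p * r \<in> ideal_generated G"

definition anticommutators :: "'n free_alg set"
  where "anticommutators = {free_var i * free_var j + free_var j * free_var i | i j. i \<noteq> j}"

lemma ideal_generated_uminus: "p \<in> ideal_generated G \<Longrightarrow> - p \<in> ideal_generated G"
  using ideal_generated.lmult[of p G "- 1"] by simp

lemma ideal_generated_diff:
  "p \<in> ideal_generated G \<Longrightarrow> q \<in> ideal_generated G \<Longrightarrow> p - q \<in> ideal_generated G"
  using ideal_generated.add[OF _ ideal_generated_uminus, of p G q] by simp

text \<open>\<open>S\<^sub>-\<^sub>1(V)\<close> for \<open>V\<close> with basis indexed by \<open>'n\<close>.\<close>

quotient_type 'n skew_poly = "'n free_alg" / "\<lambda>p q. p - q \<in> ideal_generated anticommutators"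
  morphisms rep_skew_poly skew_class
proof (rule equivpI)
  show "reflp (\<lambda>p q :: 'n free_alg. p - q \<in> ideal_generated anticommutators)"
    by (rule reflpI) (simp add: ideal_generated.zero)
  show "symp (\<lambda>p q :: 'n free_alg. p - q \<in> ideal_generated anticommutators)"
    by (rule sympI) (metis ideal_generated_uminus minus_diff_eq)
  show "transp (\<lambda>p q :: 'n free_alg. p - q \<in> ideal_generated anticommutators)"
  proof (rule transpI)
    fix p q r :: "'n free_alg"
    assume "p - q \<in> ideal_generated anticommutators" "q - r \<in> ideal_generated anticommutators"
    from ideal_generated.add[OF this] show "p - r \<in> ideal_generated anticommutators" by simp
  qed
qed

lemma free_alg_induct [case_names zero single add]:
  fixes p :: "'n free_alg"
  assumes zero: "P 0" and single: "\<And>w c. P (Poly_Mapping.single w c)"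
    and add: "\<And>p q. P p \<Longrightarrow> P q \<Longrightarrow> P (p + q)"
  shows "P p"
proof (induction p rule: update_induct)
  case const
  show ?case by (fact zero)
next
  case (update f a b)
  have "Poly_Mapping.update a b f = f + Poly_Mapping.single a b"
    using update by (intro poly_mapping_eqI)
      (auto simp: lookup_update lookup_add lookup_single in_keys_iff)
  then show ?case using add[OF update(3) single] by simp
qed

lemma free_mon_add_eq_0: "u + v = 0 \<longleftrightarrow> u = 0 \<and> v = 0" for u v :: "'n free_mon"
  by (cases u; cases v) (auto simp: zero_free_mon_def plus_free_mon_def)

lemma lookup_mult_empty:
  fixes p q :: "'n free_alg"
  shows "Poly_Mapping.lookup (p * q) 0 = Poly_Mapping.lookup p 0 * Poly_Mapping.lookup q 0"
proof (induction p rule: free_alg_induct)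
  case (single u c)
  show ?case
    by (induction q rule: free_alg_induct)
       (auto simp: mult_single lookup_single when_def free_mon_add_eq_0 lookup_add ring_distribs)
qed (auto simp: lookup_add ring_distribs)

lemma one_notin_ideal: "(1 :: 'n free_alg) \<notin> ideal_generated anticommutators"
proof
  have "Poly_Mapping.lookup p 0 = 0" if "p \<in> ideal_generated anticommutators" for p :: "'n free_alg"
    using that
  proof induction
    case (gen g)
    then show ?case
      by (auto simp: anticommutators_def lookup_add free_var_def mult_single
            lookup_single zero_free_mon_def plus_free_mon_def when_def)
  qed (auto simp: lookup_add lookup_mult_empty)
  moreover assume "(1 :: 'n free_alg) \<in> ideal_generated anticommutators"
  ultimately have "Poly_Mapping.lookup (1 :: 'n free_alg) 0 = 0" by blast
  then show False by simp
qed

instantiation skew_poly :: (type) ring_1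
begin

lift_definition zero_skew_poly :: "'a skew_poly" is 0 .
lift_definition one_skew_poly :: "'a skew_poly" is 1 .
lift_definition plus_skew_poly :: "'a skew_poly \<Rightarrow> 'a skew_poly \<Rightarrow> 'a skew_poly" is "(+)"
  by (metis add_diff_add ideal_generated.add)
lift_definition uminus_skew_poly :: "'a skew_poly \<Rightarrow> 'a skew_poly" is uminus
  by (metis ideal_generated_uminus minus_diff_minus)
lift_definition minus_skew_poly :: "'a skew_poly \<Rightarrow> 'a skew_poly \<Rightarrow> 'a skew_poly" is "(-)"
proof -
  fix p q r s :: "'a free_alg"
  assume "p - q \<in> ideal_generated anticommutators" "r - s \<in> ideal_generated anticommutators"
  from ideal_generated_diff[OF this]
  show "p - r - (q - s) \<in> ideal_generated anticommutators" by (simp add: algebra_simps)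
qed
lift_definition times_skew_poly :: "'a skew_poly \<Rightarrow> 'a skew_poly \<Rightarrow> 'a skew_poly" is "(*)"
proof -
  fix p q r s :: "'a free_alg"
  assume "p - q \<in> ideal_generated anticommutators" "r - s \<in> ideal_generated anticommutators"
  then have "(p - q) * r + q * (r - s) \<in> ideal_generated anticommutators"
    by (intro ideal_generated.add ideal_generated.lmult ideal_generated.rmult)
  then show "p * r - q * s \<in> ideal_generated anticommutators" by (simp add: algebra_simps)
qed

instance
proof
  show "(0 :: 'a skew_poly) \<noteq> 1"
    by transfer (use ideal_generated_uminus[of "- 1"] one_notin_ideal in auto)
qed (transfer; simp add: algebra_simps ideal_generated.zero)+

end

lift_definition skew_scale :: "complex \<Rightarrow> 'n skew_poly \<Rightarrow> 'n skew_poly"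
  is "\<lambda>c p. free_const c * p"
  by (metis ideal_generated.lmult right_diff_distrib)

lift_definition skew_var :: "'n \<Rightarrow> 'n skew_poly" is free_var .

lemma skew_class_hom [simp]:
  "skew_class 0 = 0" "skew_class 1 = 1"
  "skew_class (p + q) = skew_class p + skew_class q"
  "skew_class (p - q) = skew_class p - skew_class q"
  "skew_class (- p) = - skew_class p"
  "skew_class (p * q) = skew_class p * skew_class q"
  "skew_class (free_const c * p) = skew_scale c (skew_class p)"
  "skew_class (free_var i) = skew_var i"
  by (simp_all add: zero_skew_poly.abs_eq one_skew_poly.abs_eq plus_skew_poly.abs_eq
      minus_skew_poly.abs_eq uminus_skew_poly.abs_eq times_skew_poly.abs_eq
      skew_scale.abs_eq skew_var.abs_eq)

lemma skew_var_anticommute: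
  assumes "i \<noteq> j"
  shows "skew_var i * skew_var j = - (skew_var j * skew_var i)"
proof -
  have "skew_class (free_var i * free_var j + free_var j * free_var i) = 0"
    unfolding zero_skew_poly.abs_eq skew_poly.abs_eq_iff
    using assms by (auto simp: anticommutators_def intro!: ideal_generated.gen)
  then show ?thesis by (simp add: eq_neg_iff_add_eq_0)
qed

lemma free_const_simps:
  "free_const 0 = 0" "free_const 1 = 1" "free_const (c + d) = free_const c + free_const d"
  "free_const (c * d) = free_const c * free_const d"
  by (simp_all add: free_const_def single_add mult_single)

lemma free_const_central: "free_const c * p = p * free_const (c :: complex)"
  by (induction p rule: free_alg_induct) (simp_all add: free_const_def mult_single algebra_simps)

interpretation skew: vector_space skew_scale
proof
  fix c d :: complex and p q :: "'n skew_poly"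
  show "skew_scale c (p + q) = skew_scale c p + skew_scale c q"
    by transfer (simp add: algebra_simps ideal_generated.zero)
  show "skew_scale (c + d) p = skew_scale c p + skew_scale d p"
    by transfer (simp add: algebra_simps free_const_simps ideal_generated.zero)
  show "skew_scale c (skew_scale d p) = skew_scale (c * d) p"
    by transfer (simp add: algebra_simps free_const_simps ideal_generated.zero)
  show "skew_scale 1 p = p"
    by transfer (simp add: free_const_simps ideal_generated.zero)
qed

lemma skew_class_cases:
  obtains q where "p = skew_class q"
  by (metis Quotient3_abs_rep[OF Quotient3_skew_poly])

lemma skew_scale_conv_mult:
  "skew_scale c p = skew_class (free_const c) * p" "skew_scale c p = p * skew_class (free_const c)"
proof -
  obtain q where q: "p = skew_class q" by (rule skew_class_cases)
  show "skew_scale c p = skew_class (free_const c) * p"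
    unfolding q skew_class_hom(7)[symmetric] by simp
  show "skew_scale c p = p * skew_class (free_const c)"
    unfolding q skew_class_hom(6,7)[symmetric] by (simp only: free_const_central)
qed

lemma skew_scale_mult [simp]:
  "skew_scale c p * q = skew_scale c (p * q)" "p * skew_scale c q = skew_scale c (p * q)"
  by (simp add: skew_scale_conv_mult(1) mult.assoc)
     (simp add: skew_scale_conv_mult(2) mult.assoc)

lemma skew_poly_induct [case_names one var scale add]:
  fixes p :: "'n skew_poly"
  assumes one: "P 1" and var: "\<And>i p. P p \<Longrightarrow> P (skew_var i * p)"
    and scale: "\<And>c p. P p \<Longrightarrow> P (skew_scale c p)" and add: "\<And>p q. P p \<Longrightarrow> P q \<Longrightarrow> P (p + q)"
  shows "P p"
proof -
  obtain q where q: "p = skew_class q" by (rule skew_class_cases)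
  have word: "P (skew_class (Poly_Mapping.single (FM w) 1))" for w :: "'n list"
  proof (induction w)
    case Nil
    show ?case using one by (simp flip: zero_free_mon_def)
  next
    case (Cons i w)
    have "Poly_Mapping.single (FM (i # w)) 1 = free_var i * Poly_Mapping.single (FM w) (1::complex)"
      by (simp add: free_var_def mult_single plus_free_mon_def)
    then show ?case using var[OF Cons.IH, of i] by simp
  qed
  have "P (skew_class q)"
  proof (induction q rule: free_alg_induct)
    case zero
    show ?case using scale[OF one, of 0] by simp
  next
    case (single w c)
    have "Poly_Mapping.single w c = free_const c * Poly_Mapping.single (FM (letters w)) 1"
      by (simp add: free_const_def mult_single)
    then show ?case using scale[OF word, of c "letters w"]
      by (metis skew_class_hom(7))
  qed (simp add: add)
  then show ?thesis by (simp add: q)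
qed


section \<open>Algebra automorphisms and braided partial derivatives of \<open>S\<^sub>-\<^sub>1(V)\<close>\<close>

definition skew_automorphism :: "('n skew_poly \<Rightarrow> 'n skew_poly) \<Rightarrow> bool"
  where "skew_automorphism f \<longleftrightarrow>
    Vector_Spaces.linear skew_scale skew_scale f \<and> f 1 = 1 \<and> (\<forall>p q. f (p * q) = f p * f q) \<and> bij f"

definition skew_aut_of :: "('n \<Rightarrow> 'n skew_poly) \<Rightarrow> 'n skew_poly \<Rightarrow> 'n skew_poly"
  where "skew_aut_of y = (THE f. skew_automorphism f \<and> (\<forall>k. f (skew_var k) = y k))"

definition skew_gamma :: "'n \<Rightarrow> 'n skew_poly \<Rightarrow> 'n skew_poly"
  where "skew_gamma i = skew_aut_of (\<lambda>k. if k = i then skew_var i else - skew_var k)"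

definition skew_t :: "complex \<Rightarrow> 'n \<Rightarrow> 'n skew_poly \<Rightarrow> 'n skew_poly"
  where "skew_t \<epsilon> i = skew_aut_of (\<lambda>k. if k = i then skew_scale \<epsilon> (skew_var i) else skew_var k)"

definition skew_sigma :: "complex \<Rightarrow> 'n \<Rightarrow> 'n \<Rightarrow> 'n skew_poly \<Rightarrow> 'n skew_poly"
  where "skew_sigma \<epsilon> i j = skew_aut_of
    (\<lambda>k. if k = i then skew_scale \<epsilon> (skew_var j)
         else if k = j then skew_scale (- inverse \<epsilon>) (skew_var i)
         else skew_var k)"

definition skew_monomial :: "('n::{finite,linorder} \<Rightarrow> nat) \<Rightarrow> 'n skew_poly"
  where "skew_monomial a = prod_list (map (\<lambda>k. skew_var k ^ a k) (sorted_list_of_set UNIV))"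

text \<open>The truncated exponent \<open>a i - 1\<close> only matters for \<open>a i > 0\<close>, as the coefficient vanishes
  otherwise.\<close>

definition skew_partial :: "'n::{finite,linorder} \<Rightarrow> 'n skew_poly \<Rightarrow> 'n skew_poly"
  where "skew_partial i = (THE D. Vector_Spaces.linear skew_scale skew_scale D \<and>
    (\<forall>a. D (skew_monomial a) =
       skew_scale (of_nat (a i) * (- 1) ^ (\<Sum>k | k < i. a k)) (skew_monomial (a(i := a i - 1)))))"


subsection \<open>Existence and uniqueness\<close>

lemma skew_linear_iff:
  "Vector_Spaces.linear skew_scale skew_scale f \<longleftrightarrow>
    (\<forall>p q. f (p + q) = f p + f q) \<and> (\<forall>c p. f (skew_scale c p) = skew_scale c (f p))"
  by (simp add: Vector_Spaces.linear_iff skew.vector_space_axioms)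

lemma skew_hom_eqI:
  assumes "Vector_Spaces.linear skew_scale skew_scale f" "f 1 = 1" "\<And>p q. f (p * q) = f p * f q"
    and "Vector_Spaces.linear skew_scale skew_scale g" "g 1 = 1" "\<And>p q. g (p * q) = g p * g q"
    and "\<And>k. f (skew_var k) = g (skew_var k)"
  shows "f p = g p"
  by (induction p rule: skew_poly_induct) (use assms in \<open>auto simp: skew_linear_iff\<close>)

definition free_lin :: "('n list \<Rightarrow> 'n skew_poly) \<Rightarrow> 'n free_alg \<Rightarrow> 'n skew_poly"
  where "free_lin g p =
    (\<Sum>w\<in>Poly_Mapping.keys p. skew_scale (Poly_Mapping.lookup p w) (g (letters w)))"

lemma free_lin_superset:
  assumes "finite A" "Poly_Mapping.keys p \<subseteq> A"
  shows "free_lin g p = (\<Sum>w\<in>A. skew_scale (Poly_Mapping.lookup p w) (g (letters w)))"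
  unfolding free_lin_def using assms
  by (intro sum.mono_neutral_left) (auto simp: in_keys_iff)

lemma free_lin_simps [simp]:
  "free_lin g 0 = 0"
  "free_lin g (Poly_Mapping.single w c) = skew_scale c (g (letters w))"
  "free_lin g (p + q) = free_lin g p + free_lin g q"
proof -
  show "free_lin g 0 = 0" by (simp add: free_lin_def)
  show "free_lin g (Poly_Mapping.single w c) = skew_scale c (g (letters w))"
    by (simp add: free_lin_superset[of "{w}"])
  let ?A = "Poly_Mapping.keys p \<union> Poly_Mapping.keys q"
  show "free_lin g (p + q) = free_lin g p + free_lin g q"
    by (simp add: free_lin_superset[of ?A] Poly_Mapping.keys_add lookup_add
        skew.scale_left_distrib sum.distrib)
qed

lemma free_lin_scale: "free_lin g (free_const c * p) = skew_scale c (free_lin g p)"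
  by (induction p rule: free_alg_induct)
     (simp_all add: free_const_def mult_single ring_distribs skew.scale_right_distrib)

lemma free_lin_diff: "free_lin g (p - q) = free_lin g p - free_lin g q"
  by (metis add_diff_cancel_right' diff_add_cancel free_lin_simps(3))

lemma free_lin_lift:
  assumes "\<And>p. p \<in> ideal_generated anticommutators \<Longrightarrow> free_lin g p = 0"
  obtains f where "Vector_Spaces.linear skew_scale skew_scale f" "\<And>p. f (skew_class p) = free_lin g p"
proof
  define f where "f p = free_lin g (rep_skew_poly p)" for p
  show f: "f (skew_class p) = free_lin g p" for p
  proof -
    have "skew_class (rep_skew_poly (skew_class p)) = skew_class p"
      by (simp add: Quotient3_abs_rep[OF Quotient3_skew_poly])
    then have "rep_skew_poly (skew_class p) - p \<in> ideal_generated anticommutators"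
      by (simp add: skew_poly.abs_eq_iff)
    from assms[OF this] show ?thesis by (simp add: f_def free_lin_diff)
  qed
  show "Vector_Spaces.linear skew_scale skew_scale f"
    unfolding skew_linear_iff
  proof (intro conjI allI)
    fix p q :: "'a skew_poly" and c
    obtain p' where p: "p = skew_class p'" by (rule skew_class_cases)
    obtain q' where q: "q = skew_class q'" by (rule skew_class_cases)
    show "f (p + q) = f p + f q"
      unfolding p q skew_class_hom[symmetric] f by simp
    show "f (skew_scale c p) = skew_scale c (f p)"
      unfolding p skew_class_hom[symmetric] f by (simp add: free_lin_scale)
  qed
qed

definition free_eval :: "('n \<Rightarrow> 'n skew_poly) \<Rightarrow> 'n free_alg \<Rightarrow> 'n skew_poly"
  where "free_eval y = free_lin (\<lambda>w. prod_list (map y w))"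

lemma free_eval_mult: "free_eval y (p * q) = free_eval y p * free_eval y q"
proof (induction p rule: free_alg_induct)
  case (single u c)
  show ?case
    by (induction q rule: free_alg_induct)
       (simp_all add: free_eval_def mult_single ring_distribs mult.commute)
qed (simp_all add: free_eval_def ring_distribs)

lemma free_eval_add: "free_eval y (p + q) = free_eval y p + free_eval y q"
  by (simp add: free_eval_def)

lemma free_eval_var: "free_eval y (free_var i) = y i"
  by (simp add: free_eval_def free_var_def)

lemma free_eval_ideal:
  assumes "\<And>i j. i \<noteq> j \<Longrightarrow> y i * y j = - (y j * y i)"
    and "p \<in> ideal_generated anticommutators"
  shows "free_eval y p = 0"
  using assms(2)
proof induction
  case (gen g)
  then obtain i j where "i \<noteq> j" "g = free_var i * free_var j + free_var j * free_var i"
    by (auto simp: anticommutators_def)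
  then show ?case
    using assms(1)[of i j]
    by (simp add: free_eval_mult free_eval_var free_eval_add)
next
  case (add p q)
  then show ?case by (simp add: free_eval_def)
qed (simp_all add: free_eval_mult, simp add: free_eval_def)

lemma skew_hom_exists:
  fixes y :: "'n \<Rightarrow> 'n skew_poly"
  assumes "\<And>i j. i \<noteq> j \<Longrightarrow> y i * y j = - (y j * y i)"
  obtains f where "Vector_Spaces.linear skew_scale skew_scale f" "f 1 = 1"
    "\<And>p q. f (p * q) = f p * f q" "\<And>k. f (skew_var k) = y k"
    "\<And>p. f (skew_class p) = free_eval y p"
proof -
  have "free_lin (\<lambda>w. prod_list (map y w)) p = 0" if "p \<in> ideal_generated anticommutators" for p
    using free_eval_ideal[of y p, OF assms that] by (simp add: free_eval_def)
  from free_lin_lift[OF this] obtain f where lin: "Vector_Spaces.linear skew_scale skew_scale f"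
    and f: "\<And>p. f (skew_class p) = free_eval y p"
    unfolding free_eval_def by blast
  show ?thesis
  proof
    have "free_eval y (Poly_Mapping.single 0 1) = 1"
      unfolding free_eval_def by (subst free_lin_simps) simp
    then show "f 1 = 1"
      unfolding skew_class_hom(2)[symmetric] f by simp
    show "f (p * q) = f p * f q" for p q
    proof -
      obtain p' where p: "p = skew_class p'" by (rule skew_class_cases)
      obtain q' where q: "q = skew_class q'" by (rule skew_class_cases)
      show ?thesis
        unfolding p q skew_class_hom(6)[symmetric] f by (rule free_eval_mult)
    qed
    show "f (skew_var k) = y k" for k
      unfolding skew_class_hom(8)[symmetric] f by (rule free_eval_var)
  qed (fact lin f)+
qed

lemma skew_aut_of_unique:
  assumes "skew_automorphism f" "\<And>k. f (skew_var k) = y k"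
  shows "skew_aut_of y = f"
  unfolding skew_aut_of_def
proof (rule the_equality)
  show "skew_automorphism f \<and> (\<forall>k. f (skew_var k) = y k)" using assms by blast
next
  fix g assume g: "skew_automorphism g \<and> (\<forall>k. g (skew_var k) = y k)"
  show "g = f"
    by (rule ext, rule skew_hom_eqI)
       (use g assms in \<open>auto simp: skew_automorphism_def\<close>)
qed

lemma skew_aut_of:
  fixes y z :: "'n \<Rightarrow> 'n skew_poly"
  assumes y: "\<And>i j. i \<noteq> j \<Longrightarrow> y i * y j = - (y j * y i)"
    and z: "\<And>i j. i \<noteq> j \<Longrightarrow> z i * z j = - (z j * z i)"
    and inv: "\<And>f k. Vector_Spaces.linear skew_scale skew_scale f \<Longrightarrow> f 1 = 1 \<Longrightarrow>
      (\<And>p q. f (p * q) = f p * f q) \<Longrightarrow> (\<And>k. f (skew_var k) = y k) \<Longrightarrow> f (z k) = skew_var k"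
      "\<And>f k. Vector_Spaces.linear skew_scale skew_scale f \<Longrightarrow> f 1 = 1 \<Longrightarrow>
      (\<And>p q. f (p * q) = f p * f q) \<Longrightarrow> (\<And>k. f (skew_var k) = z k) \<Longrightarrow> f (y k) = skew_var k"
  shows "skew_automorphism (skew_aut_of y)" "skew_aut_of y (skew_var k) = y k"
proof -
  obtain f where
    f: "Vector_Spaces.linear skew_scale skew_scale f" "f 1 = 1"
       "\<And>p q. f (p * q) = f p * f q" "\<And>k. f (skew_var k) = y k"
    by (rule skew_hom_exists[of y, OF y], assumption, rule that)
  obtain g where
    g: "Vector_Spaces.linear skew_scale skew_scale g" "g 1 = 1"
       "\<And>p q. g (p * q) = g p * g q" "\<And>k. g (skew_var k) = z k"
    by (rule skew_hom_exists[of z, OF z], assumption, rule that)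
  have fg: "f (g p) = p" for p
    by (rule skew_hom_eqI[where f = "\<lambda>p. f (g p)" and g = "\<lambda>p. p"])
       (use f g inv(1)[of f, OF f] in \<open>auto simp: skew_linear_iff\<close>)
  have gf: "g (f p) = p" for p
    by (rule skew_hom_eqI[where f = "\<lambda>p. g (f p)" and g = "\<lambda>p. p"])
       (use f g inv(2)[of g, OF g] in \<open>auto simp: skew_linear_iff\<close>)
  have "bij f" by (rule bij_betw_byWitness[where f' = g]) (auto simp: fg gf)
  then have aut: "skew_automorphism f" using f by (simp add: skew_automorphism_def)
  from skew_aut_of_unique[OF aut, of y] f(4) have "skew_aut_of y = f" by blast
  with aut f(4) show "skew_automorphism (skew_aut_of y)" "skew_aut_of y (skew_var k) = y k"
    by simp_all
qed

lemma skew_linear_uminus: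
  assumes "Vector_Spaces.linear skew_scale skew_scale f"
  shows "f (- p) = - f p"
proof -
  have "f (skew_scale (- 1) p) = skew_scale (- 1) (f p)"
    using assms unfolding skew_linear_iff by blast
  then show ?thesis by simp
qed

lemma skew_scale_anticommute:
  assumes "i \<noteq> j"
  shows "skew_scale c (skew_var i * skew_var j) = - skew_scale c (skew_var j * skew_var i)"
    "- skew_scale c (skew_var i * skew_var j) = skew_scale c (skew_var j * skew_var i)"
    "- (skew_var i * skew_var j) = skew_var j * skew_var i"
  using skew_var_anticommute[OF assms] by simp_all

lemma skew_gamma:
  "skew_automorphism (skew_gamma i)"
  "skew_gamma i (skew_var k) = (if k = i then skew_var i else - skew_var k)"
  unfolding skew_gamma_def
  by (rule skew_aut_of[where z = "\<lambda>k. if k = i then skew_var i else - skew_var k"];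
      auto simp: skew_linear_uminus intro: skew_var_anticommute skew_scale_anticommute)+

lemma skew_t:
  assumes "\<epsilon> \<noteq> 0"
  shows "skew_automorphism (skew_t \<epsilon> i)"
    "skew_t \<epsilon> i (skew_var k) = (if k = i then skew_scale \<epsilon> (skew_var i) else skew_var k)"
  unfolding skew_t_def
  by (rule skew_aut_of[where
        z = "\<lambda>k. if k = i then skew_scale (inverse \<epsilon>) (skew_var i) else skew_var k"];
      use assms in \<open>auto simp: skew_linear_iff intro: skew_var_anticommute skew_scale_anticommute\<close>)+

lemma skew_sigma:
  assumes "\<epsilon> \<noteq> 0" "i \<noteq> j"
  shows "skew_automorphism (skew_sigma \<epsilon> i j)"
    "skew_sigma \<epsilon> i j (skew_var k) =
      (if k = i then skew_scale \<epsilon> (skew_var j)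
       else if k = j then skew_scale (- inverse \<epsilon>) (skew_var i) else skew_var k)"
  unfolding skew_sigma_def
  by (rule skew_aut_of[where z = "\<lambda>k. if k = i then skew_scale (- \<epsilon>) (skew_var j)
         else if k = j then skew_scale (inverse \<epsilon>) (skew_var i) else skew_var k"];
      use assms in \<open>auto simp: skew_linear_iff skew_linear_uminus intro: skew_var_anticommute skew_scale_anticommute\<close>)+

fun word_partial :: "'n \<Rightarrow> 'n list \<Rightarrow> 'n skew_poly" where
  "word_partial i [] = 0"
| "word_partial i (k # w) = (if k = i then prod_list (map skew_var w) else 0) +
     (if k = i then skew_var i else - skew_var k) * word_partial i w"

lemma word_partial_append:
  "word_partial i (u @ v) = word_partial i u * prod_list (map skew_var v) +
     prod_list (map (\<lambda>k. if k = i then skew_var i else - skew_var k) u) * word_partial i v"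
  by (induction u) (simp_all add: ring_distribs mult.assoc add.assoc)

lemma skew_class_eq_eval: "skew_class p = free_eval skew_var p"
proof -
  have word: "skew_class (Poly_Mapping.single (FM w) 1) = prod_list (map skew_var w)" for w :: "'a list"
  proof (induction w)
    case Nil
    show ?case by (simp flip: zero_free_mon_def)
  next
    case (Cons i w)
    have "Poly_Mapping.single (FM (i # w)) 1 = free_var i * Poly_Mapping.single (FM w) (1::complex)"
      by (simp add: free_var_def mult_single plus_free_mon_def)
    then show ?case using Cons.IH by simp
  qed
  show ?thesis
  proof (induction p rule: free_alg_induct)
    case (single w c)
    have "Poly_Mapping.single w c = free_const c * Poly_Mapping.single (FM (letters w)) 1"
      by (simp add: free_const_def mult_single)
    then have "skew_class (Poly_Mapping.single w c) =
        skew_scale c (skew_class (Poly_Mapping.single (FM (letters w)) 1))"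
      by (metis skew_class_hom(7))
    then show ?case unfolding word by (simp add: free_eval_def)
  qed (simp_all add: free_eval_def)
qed

lemma free_partial_mult:
  "free_lin (word_partial i) (p * q) = free_lin (word_partial i) p * free_eval skew_var q +
     free_eval (\<lambda>k. if k = i then skew_var i else - skew_var k) p * free_lin (word_partial i) q"
proof (induction p rule: free_alg_induct)
  case (single u c)
  show ?case
    by (induction q rule: free_alg_induct)
       (simp_all add: free_eval_def mult_single ring_distribs word_partial_append
          skew.scale_right_distrib mult.commute)
qed (simp_all add: free_eval_def ring_distribs)

lemma free_partial_ideal:
  assumes "p \<in> ideal_generated anticommutators"
  shows "free_lin (word_partial i) p = 0"
  using assms
proof induction
  case (gen g)
  then obtain j k where "j \<noteq> k" "g = free_var j * free_var k + free_var k * free_var j"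
    by (auto simp: anticommutators_def)
  moreover have "free_lin (word_partial i) (free_var j) = (if j = i then 1 else 0)" for j
    by (simp add: free_var_def)
  ultimately show ?case
    by (auto simp: free_partial_mult free_eval_var)
next
  case (lmult p r)
  from free_eval_ideal[of skew_var p, OF skew_var_anticommute lmult(1)] lmult(2)
  show ?case by (simp add: free_partial_mult)
next
  case (rmult p r)
  have "free_eval (\<lambda>k. if k = i then skew_var i else - skew_var k) p = 0"
    by (rule free_eval_ideal[OF _ rmult(1)]) (auto intro: skew_var_anticommute skew_scale_anticommute)
  with rmult(2) show ?case by (simp add: free_partial_mult)
qed simp_all

lemma skew_derivation_exists:
  fixes i :: 'n
  obtains D where "Vector_Spaces.linear skew_scale skew_scale D" "D 1 = 0"
    "\<And>k. D (skew_var k) = (if k = i then 1 else 0)"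
    "\<And>p q. D (p * q) = D p * q + skew_gamma i p * D q"
proof -
  have "\<exists>D. Vector_Spaces.linear skew_scale skew_scale D \<and>
      (\<forall>p. D (skew_class p) = free_lin (word_partial i) p)"
    by (rule free_lin_lift[OF free_partial_ideal[of _ i]]) auto
  then obtain D where lin: "Vector_Spaces.linear skew_scale skew_scale D"
      and D: "\<And>p. D (skew_class p) = free_lin (word_partial i) p" by auto
  let ?y = "\<lambda>k. if k = i then skew_var i else - skew_var k"
  have gamma: "skew_gamma i (skew_class p) = free_eval ?y p" for p
  proof -
    have anti: "a \<noteq> b \<Longrightarrow> ?y a * ?y b = - (?y b * ?y a)" for a b
      by (auto intro: skew_var_anticommute skew_scale_anticommute)
    obtain f where
      f: "Vector_Spaces.linear skew_scale skew_scale f" "f 1 = 1" "\<And>p q. f (p * q) = f p * f q"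
        "\<And>k. f (skew_var k) = ?y k" "\<And>p. f (skew_class p) = free_eval ?y p"
    proof (rule skew_hom_exists[of ?y])
      show "\<And>a b. a \<noteq> b \<Longrightarrow> ?y a * ?y b = - (?y b * ?y a)" by (fact anti)
    qed (rule that)
    have "skew_gamma i q = f q" for q
      by (rule skew_hom_eqI) (use f(1-4) skew_gamma[of i] in \<open>auto simp: skew_automorphism_def\<close>)
    then show ?thesis by (simp add: f(5))
  qed
  show ?thesis
  proof
    show "D 1 = 0"
      unfolding skew_class_hom(2)[symmetric] D by (simp flip: single_one)
    show "D (skew_var k) = (if k = i then 1 else 0)" for k
      unfolding skew_class_hom(8)[symmetric] D by (simp add: free_var_def)
    show "D (p * q) = D p * q + skew_gamma i p * D q" for p q
    proof -
      obtain p' where p: "p = skew_class p'" by (rule skew_class_cases)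
      obtain q' where q: "q = skew_class q'" by (rule skew_class_cases)
      show ?thesis
        unfolding p q skew_class_hom(6)[symmetric] D gamma free_partial_mult
        by (simp only: skew_class_eq_eval)
    qed
  qed (fact lin)
qed

lemma skew_var_power_commute:
  assumes "k \<noteq> l"
  shows "skew_var k * skew_var l ^ m = skew_scale ((- 1) ^ m) (skew_var l ^ m * skew_var k)"
proof (induction m)
  case (Suc m)
  have "skew_var k * skew_var l ^ Suc m = - (skew_var l * (skew_var k * skew_var l ^ m))"
    by (simp add: skew_var_anticommute[OF assms] flip: mult.assoc)
  also have "\<dots> = skew_scale ((- 1) ^ Suc m) (skew_var l ^ Suc m * skew_var k)"
    by (simp add: Suc mult.assoc)
  finally show ?case .
qed simp

lemma prod_list_fun_upd:
  "i \<notin> set ks \<Longrightarrow> prod_list (map (\<lambda>k. skew_var k ^ (if k = i then m else a k)) ks) =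
     prod_list (map (\<lambda>k. skew_var k ^ a k) ks)"
  by (intro arg_cong[where f = prod_list] map_cong) auto

lemma var_times_ordered_product:
  fixes a :: "'n::linorder \<Rightarrow> nat"
  assumes "sorted_wrt (<) ks" "i \<in> set ks"
  shows "skew_var i * prod_list (map (\<lambda>k. skew_var k ^ a k) ks) =
    skew_scale ((- 1) ^ (\<Sum>k | k \<in> set ks \<and> k < i. a k))
      (prod_list (map (\<lambda>k. skew_var k ^ (a(i := Suc (a i))) k) ks))"
  using assms
proof (induction ks)
  case (Cons l ks)
  show ?case
  proof (cases "l = i")
    case True
    with Cons have *: "i \<notin> set ks" "{k. (k = i \<or> k \<in> set ks) \<and> k < i} = {}" by auto
    show ?thesis by (simp add: True * prod_list_fun_upd mult.assoc)
  next
    case False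
    with Cons have *: "l < i" "i \<in> set ks" "l \<notin> set ks" by auto
    then have "{k. k \<in> set (l # ks) \<and> k < i} = insert l {k. k \<in> set ks \<and> k < i}" by auto
    then have sum: "(\<Sum>k | k \<in> set (l # ks) \<and> k < i. a k) = a l + (\<Sum>k | k \<in> set ks \<and> k < i. a k)"
      using * by simp
    have "skew_var i * prod_list (map (\<lambda>k. skew_var k ^ a k) (l # ks)) =
      skew_scale ((- 1) ^ a l) (skew_var l ^ a l * (skew_var i * prod_list (map (\<lambda>k. skew_var k ^ a k) ks)))"
      using False by (simp add: skew_var_power_commute flip: mult.assoc)
    also have "\<dots> = skew_scale ((- 1) ^ (\<Sum>k | k \<in> set (l # ks) \<and> k < i. a k))
      (prod_list (map (\<lambda>k. skew_var k ^ (a(i := Suc (a i))) k) (l # ks)))"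
      using Cons * False unfolding sum by (simp add: power_add)
    finally show ?thesis .
  qed
qed simp

lemma skew_monomial_span: "p \<in> skew.span (range skew_monomial)"
proof (induction p rule: skew_poly_induct)
  case one
  have "skew_monomial (\<lambda>_. 0) = 1"
    by (simp add: skew_monomial_def map_replicate_const)
  then show ?case by (metis rangeI skew.span_base)
next
  case (var i p)
  from var show ?case
  proof (induction rule: skew.span_induct)
    case base
    show ?case
      by (auto intro!: skew.subspaceI simp: ring_distribs skew.span_zero skew.span_add skew.span_scale)
  next
    case (step x)
    then obtain a where "x = skew_monomial a" by auto
    then have "skew_var i * x =
        skew_scale ((- 1) ^ (\<Sum>k | k < i. a k)) (skew_monomial (a(i := Suc (a i))))"
      using var_times_ordered_product[of "sorted_list_of_set UNIV" i a]
      by (simp add: skew_monomial_def)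
    then show ?case by (simp add: skew.span_scale skew.span_base)
  qed
qed (auto intro: skew.span_scale skew.span_add)

lemma skew_linear_eqI:
  assumes "Vector_Spaces.linear skew_scale skew_scale f" "Vector_Spaces.linear skew_scale skew_scale g"
    and "\<And>a. f (skew_monomial a) = g (skew_monomial a)"
  shows "f = g"
proof
  fix p :: "'a skew_poly"
  show "f p = g p"
    using skew_monomial_span[of p]
  proof (induction rule: skew.span_induct)
    case base
    have "f 0 = g 0" using assms(1,2) by (metis skew.scale_zero_left skew_linear_iff)
    then show ?case
      using assms(1,2) by (auto intro!: skew.subspaceI simp: skew_linear_iff)
  qed (use assms(3) in auto)
qed

lemma derivation_ordered_product:
  fixes a :: "'n::linorder \<Rightarrow> nat"
  assumes D: "Vector_Spaces.linear skew_scale skew_scale D" "D 1 = 0"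
    "\<And>k. D (skew_var k) = (if k = i then 1 else 0)"
    "\<And>p q. D (p * q) = D p * q + skew_gamma i p * D q"
    and ks: "sorted_wrt (<) ks"
  shows "D (prod_list (map (\<lambda>k. skew_var k ^ a k) ks)) =
    (if i \<in> set ks then skew_scale (of_nat (a i) * (- 1) ^ (\<Sum>k | k \<in> set ks \<and> k < i. a k))
      (prod_list (map (\<lambda>k. skew_var k ^ (a(i := a i - 1)) k) ks)) else 0)"
  using ks
proof (induction ks)
  case Nil
  show ?case using D by simp
next
  case (Cons l ks)
  have gamma_pow: "skew_gamma i (skew_var l ^ m) = skew_scale ((- 1) ^ m) (skew_var l ^ m)" if "l \<noteq> i" for m
    using skew_gamma(1)[of i] that
    by (induction m) (auto simp: skew_automorphism_def skew_gamma(2))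
  have D_pow: "D (skew_var l ^ m) = 0" if "l \<noteq> i" for m
    using that by (induction m) (auto simp: D)
  have D_pow_i: "D (skew_var i ^ m) = skew_scale (of_nat m) (skew_var i ^ (m - 1))" for m
  proof (induction m)
    case (Suc m)
    have "skew_var i * skew_scale (of_nat m) (skew_var i ^ (m - 1)) = skew_scale (of_nat m) (skew_var i ^ m)"
      by (cases m) simp_all
    with Suc show ?case
      by (simp add: D(2-) skew_gamma(2) skew.scale_left_distrib)
  qed (simp add: D(2))
  show ?case
  proof (cases "l = i")
    case True
    with Cons have *: "i \<notin> set ks" "{k. (k = i \<or> k \<in> set ks) \<and> k < i} = {}" by auto
    from Cons * have "D (prod_list (map (\<lambda>k. skew_var k ^ a k) ks)) = 0" by simp
    then show ?thesis
      by (simp add: True * prod_list_fun_upd D(4) D_pow_i)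
  next
    case False
    show ?thesis
    proof (cases "i \<in> set ks")
      case True
      with False Cons have *: "l < i" "l \<notin> set ks" by auto
      then have "{k. k \<in> set (l # ks) \<and> k < i} = insert l {k. k \<in> set ks \<and> k < i}" by auto
      then have sum: "(\<Sum>k | k \<in> set (l # ks) \<and> k < i. a k) = a l + (\<Sum>k | k \<in> set ks \<and> k < i. a k)"
        using * by simp
      show ?thesis
        using Cons True False * unfolding sum
        by (simp add: D(4) D_pow gamma_pow power_add mult.left_commute)
    next
      case i: False
      then show ?thesis using Cons False by (simp add: D(4) D_pow)
    qed
  qed
qed

lemma skew_partial:
  fixes i :: "'n::{finite,linorder}"
  shows skew_partial_linear: "Vector_Spaces.linear skew_scale skew_scale (skew_partial i)"
    and skew_partial_monomial: "skew_partial i (skew_monomial a) =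
      skew_scale (of_nat (a i) * (- 1) ^ (\<Sum>k | k < i. a k)) (skew_monomial (a(i := a i - 1)))"
    and skew_partial_one: "skew_partial i 1 = 0"
    and skew_partial_var: "skew_partial i (skew_var k) = (if k = i then 1 else 0)"
    and skew_partial_mult: "skew_partial i (p * q) = skew_partial i p * q + skew_gamma i p * skew_partial i q"
proof -
  obtain D where D: "Vector_Spaces.linear skew_scale skew_scale D" "D 1 = 0"
    "\<And>k. D (skew_var k) = (if k = i then 1 else 0)"
    "\<And>p q. D (p * q) = D p * q + skew_gamma i p * D q"
    using skew_derivation_exists[of i] by blast
  have mono: "D (skew_monomial a) =
      skew_scale (of_nat (a i) * (- 1) ^ (\<Sum>k | k < i. a k)) (skew_monomial (a(i := a i - 1)))" for a
    using derivation_ordered_product[OF D, of "sorted_list_of_set UNIV" a]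
    by (simp add: skew_monomial_def)
  have eq: "skew_partial i = D"
    unfolding skew_partial_def
    by (rule the_equality) (use D(1) mono in \<open>auto intro: skew_linear_eqI\<close>)
  show "Vector_Spaces.linear skew_scale skew_scale (skew_partial i)"
    "skew_partial i (skew_monomial a) =
      skew_scale (of_nat (a i) * (- 1) ^ (\<Sum>k | k < i. a k)) (skew_monomial (a(i := a i - 1)))"
    "skew_partial i 1 = 0" "skew_partial i (skew_var k) = (if k = i then 1 else 0)"
    "skew_partial i (p * q) = skew_partial i p * q + skew_gamma i p * skew_partial i q"
    unfolding eq by (fact D mono)+
qed

section \<open>Extension to the skew-field of fractions\<close>

text \<open>A skew-field of fractions of a ring is given by an embedding \<open>\<iota>\<close> into a division ring all of
  whose elements are fractions of elements of the image.\<close>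

locale skew_field_of_fractions =
  fixes \<iota> :: "'a::ring_1 \<Rightarrow> 'k::division_ring"
  assumes embed_add: "\<iota> (a + b) = \<iota> a + \<iota> b"
    and embed_mult: "\<iota> (a * b) = \<iota> a * \<iota> b"
    and embed_one: "\<iota> 1 = 1"
    and embed_inj: "inj \<iota>"
    and fraction: "\<exists>a b. b \<noteq> 0 \<and> u = \<iota> a / \<iota> b"

text \<open>\<open>frac_extend \<iota> f\<close> is the unique ring automorphism extending \<open>f\<close>; it is complex linear if
  \<open>f\<close> is, since the scalars are elements of \<open>S\<^sub>-\<^sub>1(V)\<close>.  \<open>frac_partial\<close> is the unique additive
  extension satisfying the braided Leibniz rule.\<close>

definition frac_extend :: "('a::ring_1 \<Rightarrow> 'k::division_ring) \<Rightarrow> ('a \<Rightarrow> 'a) \<Rightarrow> 'k \<Rightarrow> 'k"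
  where "frac_extend \<iota> f = (THE F. bij F \<and> F 1 = 1 \<and> (\<forall>u v. F (u + v) = F u + F v) \<and>
    (\<forall>u v. F (u * v) = F u * F v) \<and> (\<forall>a. F (\<iota> a) = \<iota> (f a)))"

definition frac_partial ::
  "('n::{finite,linorder} skew_poly \<Rightarrow> 'k::division_ring) \<Rightarrow> 'n \<Rightarrow> 'k \<Rightarrow> 'k"
  where "frac_partial \<iota> i = (THE D. (\<forall>u v. D (u + v) = D u + D v) \<and>
    (\<forall>u v. D (u * v) = D u * v + frac_extend \<iota> (skew_gamma i) u * D v) \<and>
    (\<forall>a. D (\<iota> a) = \<iota> (skew_partial i a)))"

definition frac_scale :: "('n skew_poly \<Rightarrow> 'k::division_ring) \<Rightarrow> complex \<Rightarrow> 'k \<Rightarrow> 'k"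
  where "frac_scale \<iota> c u = \<iota> (skew_scale c 1) * u"


subsection \<open>Existence and uniqueness\<close>

context skew_field_of_fractions
begin

lemma embed_zero [simp]: "\<iota> 0 = 0"
  using embed_add[of 0 0] by simp

lemma embed_uminus: "\<iota> (- a) = - \<iota> a"
  using embed_add[of a "- a"] by (simp add: eq_neg_iff_add_eq_0 add.commute)

lemma embed_diff: "\<iota> (a - b) = \<iota> a - \<iota> b"
  using embed_add[of a "- b"] by (simp add: embed_uminus)

lemma embed_eq_iff [simp]: "\<iota> a = \<iota> b \<longleftrightarrow> a = b"
  using embed_inj by (auto dest: injD)

lemma embed_eq_0_iff [simp]: "\<iota> a = 0 \<longleftrightarrow> a = 0"
  using embed_eq_iff[of a 0] by simp

lemma domain_mult_eq_0_iff: "a * b = 0 \<longleftrightarrow> a = 0 \<or> b = 0" for a b :: 'a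
  using embed_mult[of a b] embed_eq_0_iff[of "a * b"] by auto

lemma fraction_mult:
  obtains a b where "b \<noteq> 0" "u * \<iota> b = \<iota> a"
proof -
  obtain a b where "b \<noteq> 0" "u = \<iota> a / \<iota> b" using fraction by blast
  then show ?thesis by (intro that[of b a]) (simp_all add: divide_inverse mult.assoc)
qed

lemma right_Ore:
  fixes a b :: 'a
  assumes "b \<noteq> 0"
  obtains u v where "v \<noteq> 0" "a * v = b * u"
proof -
  obtain u v where uv: "v \<noteq> 0" "(inverse (\<iota> b) * \<iota> a) * \<iota> v = \<iota> u" by (rule fraction_mult)
  have "\<iota> (b * u) = \<iota> b * (inverse (\<iota> b) * \<iota> a * \<iota> v)" by (simp add: embed_mult uv(2))
  also have "\<dots> = \<iota> (a * v)" using assms by (simp add: embed_mult flip: mult.assoc)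
  finally have "a * v = b * u" by simp
  then show ?thesis by (rule that[OF uv(1)])
qed

lemma common_denominator:
  obtains a b c where "c \<noteq> 0" "u * \<iota> c = \<iota> a" "v * \<iota> c = \<iota> b"
proof -
  obtain a b where ab: "b \<noteq> 0" "u * \<iota> b = \<iota> a" by (rule fraction_mult)
  obtain c d where cd: "d \<noteq> 0" "v * \<iota> d = \<iota> c" by (rule fraction_mult)
  obtain x y where xy: "y \<noteq> 0" "b * y = d * x" using right_Ore[OF cd(1)] by metis
  show ?thesis
  proof
    show "b * y \<noteq> 0" using ab(1) xy(1) by (simp add: domain_mult_eq_0_iff)
    show "u * \<iota> (b * y) = \<iota> (a * y)" by (simp add: embed_mult ab(2) flip: mult.assoc)
    show "v * \<iota> (b * y) = \<iota> (c * x)" unfolding xy(2) by (simp add: embed_mult cd(2) flip: mult.assoc)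
  qed
qed

lemma mult_denominator:
  obtains a b c d where "b \<noteq> 0" "c \<noteq> 0" "v * \<iota> b = \<iota> a" "u * \<iota> c = \<iota> d"
    "\<exists>x y. y \<noteq> 0 \<and> a * y = c * x"
proof -
  obtain a b where ab: "b \<noteq> 0" "v * \<iota> b = \<iota> a" by (rule fraction_mult)
  obtain d c where cd: "c \<noteq> 0" "u * \<iota> c = \<iota> d" by (rule fraction_mult)
  from right_Ore[OF cd(1)] have "\<exists>x y. y \<noteq> 0 \<and> a * y = c * x" by metis
  with ab cd show ?thesis using that by blast
qed

lemma frac_extend_unique:
  assumes F: "bij F" "F 1 = 1" "\<And>u v. F (u + v) = F u + F v" "\<And>u v. F (u * v) = F u * F v"
    "\<And>a. F (\<iota> a) = \<iota> (f a)"
  shows "frac_extend \<iota> f = F"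
  unfolding frac_extend_def
proof (rule the_equality)
  fix G assume "bij G \<and> G 1 = 1 \<and> (\<forall>u v. G (u + v) = G u + G v) \<and>
    (\<forall>u v. G (u * v) = G u * G v) \<and> (\<forall>a. G (\<iota> a) = \<iota> (f a))"
  then have G: "G (u * v) = G u * G v" "G (\<iota> a) = \<iota> (f a)" for u v a by auto
  show "G = F"
  proof
    fix u
    obtain a b where ab: "b \<noteq> 0" "u * \<iota> b = \<iota> a" by (rule fraction_mult)
    have "F 0 = 0" using F(3)[of 0 0] by simp
    then have "\<iota> (f b) \<noteq> 0"
      using ab(1) F(1) unfolding F(5)[symmetric] by (metis bij_is_inj embed_eq_0_iff injD)
    moreover have "G u * \<iota> (f b) = F u * \<iota> (f b)"
      by (metis G F(4,5) ab(2))
    ultimately show "G u = F u" by simp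
  qed
qed (use F in auto)

lemma frac_extend:
  assumes "bij f" "f 1 = 1" "\<And>a b. f (a + b) = f a + f b" "\<And>a b. f (a * b) = f a * f b"
  shows frac_extend_bij: "bij (frac_extend \<iota> f)"
    and frac_extend_one: "frac_extend \<iota> f 1 = 1"
    and frac_extend_add: "frac_extend \<iota> f (u + v) = frac_extend \<iota> f u + frac_extend \<iota> f v"
    and frac_extend_mult: "frac_extend \<iota> f (u * v) = frac_extend \<iota> f u * frac_extend \<iota> f v"
    and frac_extend_embed: "frac_extend \<iota> f (\<iota> a) = \<iota> (f a)"
proof -
  have f0: "f a = 0 \<longleftrightarrow> a = 0" for a
  proof -
    have "f 0 = 0" using assms(3)[of 0 0] by simp
    then show ?thesis using assms(1) by (metis bij_is_inj injD)
  qed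
  have ex: "\<exists>w. \<forall>a b. b \<noteq> 0 \<longrightarrow> u * \<iota> b = \<iota> a \<longrightarrow> w * \<iota> (f b) = \<iota> (f a)" for u
  proof -
    obtain a b where ab: "b \<noteq> 0" "u * \<iota> b = \<iota> a" by (rule fraction_mult)
    define w where "w = \<iota> (f a) / \<iota> (f b)"
    have w: "w * \<iota> (f b) = \<iota> (f a)"
      using ab(1) by (simp add: w_def f0 divide_inverse mult.assoc)
    have "w * \<iota> (f d) = \<iota> (f c)" if cd: "d \<noteq> 0" "u * \<iota> d = \<iota> c" for c d
    proof -
      obtain x y where xy: "y \<noteq> 0" "d * y = b * x" using right_Ore[OF ab(1)] by metis
      have "\<iota> (c * y) = u * \<iota> (d * y)" by (simp add: embed_mult cd(2) flip: mult.assoc)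
      also have "\<dots> = \<iota> (a * x)" unfolding xy(2) by (simp add: embed_mult ab(2) flip: mult.assoc)
      finally have cy: "c * y = a * x" by simp
      have "w * \<iota> (f d) * \<iota> (f y) = w * \<iota> (f (d * y))"
        by (simp add: assms(4) embed_mult mult.assoc)
      also have "\<dots> = \<iota> (f (a * x))"
        unfolding xy(2) by (simp add: assms(4) embed_mult w flip: mult.assoc)
      also have "\<dots> = \<iota> (f c) * \<iota> (f y)"
        unfolding cy[symmetric] by (simp add: assms(4) embed_mult)
      finally show ?thesis using xy(1) by (simp add: f0)
    qed
    then show ?thesis by blast
  qed
  then obtain F where F: "\<And>u a b. b \<noteq> 0 \<Longrightarrow> u * \<iota> b = \<iota> a \<Longrightarrow> F u * \<iota> (f b) = \<iota> (f a)"
    by metis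
  have F_embed: "F (\<iota> a) = \<iota> (f a)" for a
    using F[of 1 "\<iota> a" a] by (simp add: embed_one assms(2))
  have F_one: "F 1 = 1" using F_embed[of 1] by (simp add: embed_one assms(2))
  have F_add: "F (u + v) = F u + F v" for u v
  proof -
    obtain a b c where abc: "c \<noteq> 0" "u * \<iota> c = \<iota> a" "v * \<iota> c = \<iota> b" by (rule common_denominator)
    have "(u + v) * \<iota> c = \<iota> (a + b)" by (simp add: ring_distribs abc embed_add)
    from F[OF abc(1) this] have "F (u + v) * \<iota> (f c) = (F u + F v) * \<iota> (f c)"
      by (simp add: ring_distribs assms(3) embed_add F[OF abc(1,2)] F[OF abc(1,3)])
    then show ?thesis using abc(1) by (simp add: f0)
  qed
  have F_mult: "F (u * v) = F u * F v" for u v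
  proof -
    obtain a b c d x y where *: "b \<noteq> 0" "c \<noteq> 0" "v * \<iota> b = \<iota> a" "u * \<iota> c = \<iota> d"
      "y \<noteq> 0" "a * y = c * x" using mult_denominator[of v u] by metis
    have by0: "b * y \<noteq> 0" using * by (simp add: domain_mult_eq_0_iff)
    have "u * v * \<iota> (b * y) = u * (v * \<iota> b * \<iota> y)" by (simp add: embed_mult mult.assoc)
    also have "\<dots> = u * \<iota> (c * x)" by (simp add: *(3) *(6)[symmetric] embed_mult)
    also have "\<dots> = \<iota> (d * x)" by (simp add: embed_mult *(4) flip: mult.assoc)
    finally have "F (u * v) * \<iota> (f (b * y)) = \<iota> (f (d * x))" by (rule F[OF by0])
    also have "\<dots> = F u * \<iota> (f (c * x))"
      by (simp add: assms(4) embed_mult F[OF *(2,4)] flip: mult.assoc)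
    also have "\<dots> = F u * F v * \<iota> (f (b * y))"
      unfolding *(6)[symmetric] by (simp add: assms(4) embed_mult mult.assoc F[OF *(1,3), symmetric])
    finally show ?thesis using by0 by (simp add: f0)
  qed
  have "inj F"
  proof (rule injI)
    fix u v assume uv: "F u = F v"
    obtain a b c where abc: "c \<noteq> 0" "u * \<iota> c = \<iota> a" "v * \<iota> c = \<iota> b" by (rule common_denominator)
    from F[OF abc(1,2)] F[OF abc(1,3)] uv have "f a = f b" by simp
    then have "a = b" using assms(1) by (meson bij_is_inj injD)
    with abc have "u * \<iota> c = v * \<iota> c" by simp
    with abc(1) show "u = v" by simp
  qed
  moreover have "surj F"
  proof (rule surjI)
    fix w
    obtain a b where ab: "b \<noteq> 0" "w * \<iota> b = \<iota> a" by (rule fraction_mult)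
    define a' b' where "a' = inv_into UNIV f a" and "b' = inv_into UNIV f b"
    have f': "f a' = a" "f b' = b"
      using assms(1) by (simp_all add: a'_def b'_def bij_is_surj surj_f_inv_f)
    have b'0: "b' \<noteq> 0" using f'(2) ab(1) f0 by metis
    have "\<exists>u. F u = w"
    proof
      have "(\<iota> a' / \<iota> b') * \<iota> b' = \<iota> a'" using b'0 by (simp add: divide_inverse mult.assoc)
      from F[OF b'0 this] have "F (\<iota> a' / \<iota> b') * \<iota> b = w * \<iota> b" by (simp add: f' ab(2))
      then show "F (\<iota> a' / \<iota> b') = w" using ab(1) by simp
    qed
    then show "F (SOME u. F u = w) = w" by (rule someI_ex)
  qed
  ultimately have F_bij: "bij F" by (rule bijI)
  have eq: "frac_extend \<iota> f = F"
    by (rule frac_extend_unique[OF F_bij F_one F_add F_mult F_embed])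
  show "bij (frac_extend \<iota> f)" "frac_extend \<iota> f 1 = 1"
    "frac_extend \<iota> f (u + v) = frac_extend \<iota> f u + frac_extend \<iota> f v"
    "frac_extend \<iota> f (u * v) = frac_extend \<iota> f u * frac_extend \<iota> f v"
    "frac_extend \<iota> f (\<iota> a) = \<iota> (f a)"
    unfolding eq by (fact F_bij F_one F_add F_mult F_embed)+
qed

end

lemma frac_partial:
  fixes \<iota> :: "'n::{finite,linorder} skew_poly \<Rightarrow> 'k::division_ring"
  assumes "skew_field_of_fractions \<iota>"
  shows frac_partial_add: "frac_partial \<iota> i (u + v) = frac_partial \<iota> i u + frac_partial \<iota> i v"
    and frac_partial_mult: "frac_partial \<iota> i (u * v) =
      frac_partial \<iota> i u * v + frac_extend \<iota> (skew_gamma i) u * frac_partial \<iota> i v"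
    and frac_partial_embed: "frac_partial \<iota> i (\<iota> a) = \<iota> (skew_partial i a)"
proof -
  interpret skew_field_of_fractions \<iota> by (fact assms)
  let ?d = "skew_partial i" and ?g = "skew_gamma i" and ?G = "frac_extend \<iota> (skew_gamma i)"
  have g: "bij ?g" "?g 1 = 1" "?g (a + b) = ?g a + ?g b" "?g (a * b) = ?g a * ?g b" for a b
    using skew_gamma(1)[of i] by (auto simp: skew_automorphism_def skew_linear_iff)
  note G = frac_extend[of ?g, OF g]
  have d_add: "?d (a + b) = ?d a + ?d b" for a b
    using skew_partial_linear[of i] by (simp add: skew_linear_iff)
  note d_mult = skew_partial_mult[of i]
  have ex: "\<exists>w. \<forall>a b. b \<noteq> 0 \<longrightarrow> u * \<iota> b = \<iota> a \<longrightarrow> w * \<iota> b + ?G u * \<iota> (?d b) = \<iota> (?d a)" for u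
  proof -
    obtain a b where ab: "b \<noteq> 0" "u * \<iota> b = \<iota> a" by (rule fraction_mult)
    define w where "w = (\<iota> (?d a) - ?G u * \<iota> (?d b)) / \<iota> b"
    have w: "w * \<iota> b + ?G u * \<iota> (?d b) = \<iota> (?d a)"
      using ab(1) by (simp add: w_def divide_inverse mult.assoc)
    have Gab: "?G u * \<iota> (?g b) = \<iota> (?g a)" by (metis G(4,5) ab(2))
    have "w * \<iota> d + ?G u * \<iota> (?d d) = \<iota> (?d c)" if cd: "d \<noteq> 0" "u * \<iota> d = \<iota> c" for c d
    proof -
      have Gcd: "?G u * \<iota> (?g d) = \<iota> (?g c)" by (metis G(4,5) cd(2))
      obtain x y where xy: "y \<noteq> 0" "d * y = b * x" using right_Ore[OF ab(1)] by metis
      have "\<iota> (c * y) = u * \<iota> (d * y)" by (simp add: embed_mult cd(2) flip: mult.assoc)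
      also have "\<dots> = \<iota> (a * x)" unfolding xy(2) by (simp add: embed_mult ab(2) flip: mult.assoc)
      finally have cy: "c * y = a * x" by simp
      have "w * \<iota> (b * x) + ?G u * \<iota> (?d (b * x)) =
          (w * \<iota> b + ?G u * \<iota> (?d b)) * \<iota> x + ?G u * \<iota> (?g b) * \<iota> (?d x)"
        by (simp add: d_mult embed_add embed_mult ring_distribs mult.assoc add.assoc)
      also have "\<dots> = \<iota> (?d (a * x))"
        unfolding w Gab by (simp add: d_mult embed_add embed_mult)
      finally have 1: "w * \<iota> (d * y) + ?G u * \<iota> (?d (d * y)) = \<iota> (?d (c * y))"
        by (simp add: xy(2) cy)
      have "w * \<iota> (d * y) + ?G u * \<iota> (?d (d * y)) =
          (w * \<iota> d + ?G u * \<iota> (?d d)) * \<iota> y + ?G u * \<iota> (?g d) * \<iota> (?d y)"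
        by (simp add: d_mult embed_add embed_mult ring_distribs mult.assoc add.assoc)
      with 1 have "(w * \<iota> d + ?G u * \<iota> (?d d)) * \<iota> y = \<iota> (?d c) * \<iota> y"
        unfolding Gcd by (auto simp: d_mult embed_add embed_mult)
      then show ?thesis using xy(1) by auto
    qed
    then show ?thesis by blast
  qed
  then obtain D where D: "\<And>u a b. b \<noteq> 0 \<Longrightarrow> u * \<iota> b = \<iota> a \<Longrightarrow>
      D u * \<iota> b + ?G u * \<iota> (?d b) = \<iota> (?d a)"
    by metis
  have D_embed: "D (\<iota> a) = \<iota> (?d a)" for a
    using D[of 1 "\<iota> a" a] by (simp add: embed_one skew_partial_one)
  have D_add: "D (u + v) = D u + D v" for u v
  proof -
    obtain a b c where abc: "c \<noteq> 0" "u * \<iota> c = \<iota> a" "v * \<iota> c = \<iota> b" by (rule common_denominator)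
    have "(u + v) * \<iota> c = \<iota> (a + b)" by (simp add: ring_distribs abc embed_add)
    from D[OF abc(1) this] have "D (u + v) * \<iota> c + (?G u + ?G v) * \<iota> (?d c) = \<iota> (?d a) + \<iota> (?d b)"
      by (simp add: G(3) d_add embed_add)
    also have "\<dots> = (D u + D v) * \<iota> c + (?G u + ?G v) * \<iota> (?d c)"
      by (simp add: D[OF abc(1,2), symmetric] D[OF abc(1,3), symmetric] ring_distribs algebra_simps)
    finally show ?thesis using abc(1) by simp
  qed
  have D_mult: "D (u * v) = D u * v + ?G u * D v" for u v
  proof -
    obtain a b c d x y where *: "b \<noteq> 0" "c \<noteq> 0" "v * \<iota> b = \<iota> a" "u * \<iota> c = \<iota> d"
      "y \<noteq> 0" "a * y = c * x" using mult_denominator[of v u] by metis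
    have by0: "b * y \<noteq> 0" using * by (simp add: domain_mult_eq_0_iff)
    have Guc: "?G u * \<iota> (?g c) = \<iota> (?g d)" by (metis G(4,5) *(4))
    have Gvb: "?G v * \<iota> (?g b) = \<iota> (?g a)" by (metis G(4,5) *(3))
    have vby: "v * \<iota> (b * y) = \<iota> (c * x)"
      by (simp add: *(3) *(6)[symmetric] embed_mult flip: mult.assoc)
    have "u * v * \<iota> (b * y) = u * \<iota> (c * x)" by (simp add: vby mult.assoc)
    also have "\<dots> = \<iota> (d * x)" by (simp add: embed_mult *(4) flip: mult.assoc)
    finally have "D (u * v) * \<iota> (b * y) + ?G (u * v) * \<iota> (?d (b * y)) = \<iota> (?d (d * x))"
      by (rule D[OF by0])
    also have "\<dots> = \<iota> (?d d) * \<iota> x + \<iota> (?g d) * \<iota> (?d x)"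
      by (simp add: d_mult embed_add embed_mult)
    also have "\<dots> = D u * \<iota> (c * x) + ?G u * \<iota> (?d (c * x))"
      unfolding D[OF *(2,4), symmetric] Guc[symmetric]
      by (simp add: d_mult embed_add embed_mult ring_distribs mult.assoc add.assoc)
    also have "\<iota> (?d (c * x)) = D v * \<iota> (b * y) + ?G v * \<iota> (?d (b * y))"
      by (rule D[OF by0 vby, symmetric])
    also have "D u * \<iota> (c * x) + ?G u * (D v * \<iota> (b * y) + ?G v * \<iota> (?d (b * y))) =
        (D u * v + ?G u * D v) * \<iota> (b * y) + ?G (u * v) * \<iota> (?d (b * y))"
      unfolding vby[symmetric] by (simp add: G(4) ring_distribs mult.assoc add.assoc)
    finally show ?thesis using by0 by simp
  qed
  have eq: "frac_partial \<iota> i = D"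
    unfolding frac_partial_def
  proof (rule the_equality)
    fix E assume "(\<forall>u v. E (u + v) = E u + E v) \<and> (\<forall>u v. E (u * v) = E u * v + ?G u * E v) \<and>
      (\<forall>a. E (\<iota> a) = \<iota> (?d a))"
    then have E: "E (u * v) = E u * v + ?G u * E v" "E (\<iota> a) = \<iota> (?d a)" for u v a by auto
    show "E = D"
    proof
      fix u
      obtain a b where ab: "b \<noteq> 0" "u * \<iota> b = \<iota> a" by (rule fraction_mult)
      have "E u * \<iota> b + ?G u * \<iota> (?d b) = D u * \<iota> b + ?G u * \<iota> (?d b)"
        using E(1)[of u "\<iota> b"] D[OF ab] by (auto simp: E(2) ab(2))
      then show "E u = D u" using ab(1) by auto
    qed
  qed (use D_add D_mult D_embed in auto)
  show "frac_partial \<iota> i (u + v) = frac_partial \<iota> i u + frac_partial \<iota> i v"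
    "frac_partial \<iota> i (u * v) = frac_partial \<iota> i u * v + ?G u * frac_partial \<iota> i v"
    "frac_partial \<iota> i (\<iota> a) = \<iota> (?d a)"
    unfolding eq by (fact D_add D_mult D_embed)+
qed


section \<open>Braided Dunkl operators\<close>

definition complex_units :: "complex monoid"
  where "complex_units = \<lparr>carrier = UNIV - {0}, mult = (*), one = 1\<rparr>"

lemma group_complex_units: "group complex_units"
proof (rule groupI)
  fix x assume "x \<in> carrier complex_units"
  then show "\<exists>y\<in>carrier complex_units. y \<otimes>\<^bsub>complex_units\<^esub> x = \<one>\<^bsub>complex_units\<^esub>"
    by (intro bexI[of _ "inverse x"]) (auto simp: complex_units_def)
qed (auto simp: complex_units_def)

text \<open>The denominators \<open>x\<^sub>i\<^sup>2 - \<epsilon>\<^sup>2 x\<^sub>j\<^sup>2\<close> are central, so left and right quotients agree.  Only the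
  values of \<open>c\<close> on \<open>C'\<close> occur when \<open>1 \<in> C'\<close>, so \<open>c\<close> may be a total function.\<close>

definition braided_nabla ::
  "('n::{finite,linorder} skew_poly \<Rightarrow> 'k::division_ring) \<Rightarrow> complex set \<Rightarrow> complex set \<Rightarrow>
    (complex \<Rightarrow> complex) \<Rightarrow> 'n \<Rightarrow> 'k \<Rightarrow> 'k"
  where "braided_nabla \<iota> C C' c i u =
    frac_partial \<iota> i u +
    frac_scale \<iota> (c 1) (\<Sum>j\<in>UNIV - {i}. \<Sum>\<epsilon>\<in>C.
      \<iota> (skew_var i + skew_scale \<epsilon> (skew_var j)) /
      \<iota> (skew_var i ^ 2 - skew_scale (\<epsilon> ^ 2) (skew_var j ^ 2)) *
      (u - frac_extend \<iota> (skew_sigma \<epsilon> i j) u)) +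
    (\<Sum>\<epsilon>'\<in>C' - {1}. frac_scale \<iota> (c \<epsilon>' / (1 - \<epsilon>'))
      (1 / \<iota> (skew_var i) * (u - frac_extend \<iota> (skew_t \<epsilon>' i) u)))"

end

theory Submission
  imports Defs
begin

text \<open>
  As operators on the skew-field, \<open>\<nabla>\<^sub>i x\<^sub>k = \<gamma>\<^sub>i(x\<^sub>k) \<nabla>\<^sub>i + A\<^sub>i\<^sub>k\<close>, where \<open>A\<^sub>i\<^sub>k\<close> lies in the group
  algebra of the group generated by the \<open>\<sigma>\<close> and \<open>t\<close>.  As \<open>\<nabla>\<^sub>i 1 = 0\<close>, preservation of
  \<open>S\<^sub>-\<^sub>1(V)\<close> follows by induction on words.  A linear operator \<open>T\<close> with \<open>T 1 = 0\<close> and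
  \<open>T x\<^sub>k = f(x\<^sub>k) T\<close> for an automorphism \<open>f\<close> vanishes on \<open>S\<^sub>-\<^sub>1(V)\<close>, hence on left fractions, so it
  is zero.  This principle first gives the equivariance of the \<open>\<nabla>\<^sub>i\<close> under the group, because the
  \<open>A\<^sub>i\<^sub>k\<close> are equivariant, and then applies to \<open>T = \<nabla>\<^sub>i \<nabla>\<^sub>j + \<nabla>\<^sub>j \<nabla>\<^sub>i\<close> and
  \<open>f = \<gamma>\<^sub>i \<gamma>\<^sub>j\<close>: the defect of this twisted commutation is a combination of commutators and
  anticommutators of the \<open>A\<close>'s with the \<open>\<nabla>\<close>'s, which cancel by equivariance.
\<close>

section \<open>Left fractions\<close>

text \<open>Reversing words maps each anticommutator to itself, so reversal descends to the
  quotient. It turns right-hand divisibility statements into left-hand ones.\<close>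

lemma skew_antiautomorphism_exists:
  obtains r :: "'n skew_poly \<Rightarrow> 'n skew_poly"
  where "Vector_Spaces.linear skew_scale skew_scale r" "\<And>p q. r (p * q) = r q * r p"
    "\<And>p. r (r p) = p"
proof -
  let ?R = "free_lin (\<lambda>w :: 'n list. prod_list (map skew_var (rev w)))"
  have mult: "?R (p * q) = ?R q * ?R p" for p q
  proof (induction p rule: free_alg_induct)
    case (single u c)
    show ?case
      by (induction q rule: free_alg_induct)
         (simp_all add: mult_single ring_distribs skew.scale_right_distrib mult.commute)
  qed (simp_all add: ring_distribs)
  have "?R p = 0" if "p \<in> ideal_generated anticommutators" for p
    using that
  proof induction
    case (gen g)
    then obtain i j where "i \<noteq> j" "g = free_var i * free_var j + free_var j * free_var i"
      by (auto simp: anticommutators_def)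
    then show ?case
      using skew_var_anticommute[of i j] by (simp add: mult, simp add: free_var_def)
  qed (simp_all add: mult)
  from free_lin_lift[OF this] obtain r where
    lin: "Vector_Spaces.linear skew_scale skew_scale r" and r: "\<And>p. r (skew_class p) = ?R p"
    by blast
  have r_mult: "r (p * q) = r q * r p" for p q
  proof -
    obtain p' where p: "p = skew_class p'" by (rule skew_class_cases)
    obtain q' where q: "q = skew_class q'" by (rule skew_class_cases)
    show ?thesis
      unfolding p q skew_class_hom(6)[symmetric] r by (rule mult)
  qed
  have "?R (Poly_Mapping.single 0 1) = 1"
    by (subst free_lin_simps) simp
  then have r_one: "r 1 = 1" using r[of 1] by simp
  have r_var: "r (skew_var i) = skew_var i" for i
    unfolding skew_class_hom(8)[symmetric] r by (simp add: free_var_def)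
  have "r (r p) = p" for p
    by (induction p rule: skew_poly_induct)
       (use lin in \<open>simp_all add: r_one r_mult r_var skew_linear_iff\<close>)
  with lin r_mult show ?thesis using that by blast
qed

locale skew_poly_fractions = skew_field_of_fractions \<iota>
  for \<iota> :: "'n::{finite,linorder} skew_poly \<Rightarrow> 'k::division_ring"
begin

text \<open>Right fractions only supply the right Ore condition; applying the involution
  \<open>r\<close> to \<open>r a * v = r b * u\<close> gives the left one.\<close>

lemma left_Ore:
  fixes a b :: "'n skew_poly"
  assumes "b \<noteq> 0"
  obtains u v where "v \<noteq> 0" "v * a = u * b"
proof -
  obtain r :: "'n skew_poly \<Rightarrow> 'n skew_poly" where r:
    "Vector_Spaces.linear skew_scale skew_scale r" "\<And>p q. r (p * q) = r q * r p"
    "\<And>p. r (r p) = p"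
    using skew_antiautomorphism_exists by blast
  have r0: "r p = 0 \<longleftrightarrow> p = 0" for p
    by (metis r(1,3) skew.scale_zero_left skew_linear_iff)
  obtain u v where uv: "v \<noteq> 0" "r a * v = r b * u"
    using right_Ore[of "r b" "r a"] assms r0 by metis
  show ?thesis
    by (rule that[of "r v" "r u"]) (use uv in \<open>metis r0, metis r(2,3)\<close>)
qed

text \<open>Left denominators are wanted because the operators are controlled under left
  multiplication. If \<open>u\<close> is \<open>a\<close> over \<open>b\<close> and
  \<open>d * a = c * b\<close>, then \<open>d\<close> clears the denominator of \<open>u\<close>
  from the left.\<close>

lemma left_fraction:
  obtains a b where "b \<noteq> 0" "\<iota> b * u = \<iota> a"
proof -
  obtain a b where ab: "b \<noteq> 0" "u * \<iota> b = \<iota> a" by (rule fraction_mult)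
  obtain c d where cd: "d \<noteq> 0" "d * a = c * b" using left_Ore[OF ab(1)] by metis
  have "\<iota> d * u * \<iota> b = \<iota> c * \<iota> b"
    using cd(2) by (simp add: ab(2) mult.assoc flip: embed_mult)
  then have "\<iota> d * u = \<iota> c" using ab(1) by simp
  with cd(1) show ?thesis by (rule that)
qed

section \<open>Scalars and automorphisms of the skew-field\<close>

text \<open>Scalars commute with polynomials, and clearing a denominator of \<open>u\<close>
  transfers this to the skew-field, which thus becomes a complex algebra.\<close>

lemma scalar_commute: "\<iota> (skew_scale c 1) * u = u * \<iota> (skew_scale c 1)"
proof -
  obtain a b where ab: "b \<noteq> 0" "u * \<iota> b = \<iota> a" by (rule fraction_mult)
  have comm: "\<iota> (skew_scale c 1) * \<iota> p = \<iota> p * \<iota> (skew_scale c 1)" for p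
    by (simp flip: embed_mult)
  have "\<iota> (skew_scale c 1) * u * \<iota> b = \<iota> a * \<iota> (skew_scale c 1)"
    by (simp add: ab(2) mult.assoc comm)
  also have "\<dots> = u * \<iota> (skew_scale c 1) * \<iota> b"
    by (simp add: ab(2)[symmetric] mult.assoc comm)
  finally show ?thesis using ab(1) by simp
qed

lemma frac_scale_mult [simp]:
  "frac_scale \<iota> c u * v = frac_scale \<iota> c (u * v)" "u * frac_scale \<iota> c v = frac_scale \<iota> c (u * v)"
  unfolding frac_scale_def
  by (simp add: mult.assoc, metis mult.assoc scalar_commute)

lemma embed_scale: "\<iota> (skew_scale c p) = frac_scale \<iota> c (\<iota> p)"
  by (simp add: frac_scale_def flip: embed_mult)

sublocale frac: vector_space "frac_scale \<iota>"
proof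
  fix c d :: complex and u v :: 'k
  show "frac_scale \<iota> c (u + v) = frac_scale \<iota> c u + frac_scale \<iota> c v"
    by (simp add: frac_scale_def ring_distribs)
  show "frac_scale \<iota> (c + d) u = frac_scale \<iota> c u + frac_scale \<iota> d u"
    by (simp add: frac_scale_def skew.scale_left_distrib embed_add ring_distribs)
  show "frac_scale \<iota> c (frac_scale \<iota> d u) = frac_scale \<iota> (c * d) u"
    by (simp add: frac_scale_def flip: mult.assoc embed_mult)
  show "frac_scale \<iota> 1 u = u" by (simp add: frac_scale_def embed_one)
qed

lemma frac_linear_iff:
  "Vector_Spaces.linear (frac_scale \<iota>) (frac_scale \<iota>) T \<longleftrightarrow>
    (\<forall>u v. T (u + v) = T u + T v) \<and> (\<forall>c u. T (frac_scale \<iota> c u) = frac_scale \<iota> c (T u))"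
  by (simp add: Vector_Spaces.linear_iff frac.vector_space_axioms)

lemma frac_aut:
  assumes "skew_automorphism f"
  shows frac_aut_one: "frac_extend \<iota> f 1 = 1"
    and frac_aut_add: "frac_extend \<iota> f (u + v) = frac_extend \<iota> f u + frac_extend \<iota> f v"
    and frac_aut_mult: "frac_extend \<iota> f (u * v) = frac_extend \<iota> f u * frac_extend \<iota> f v"
    and frac_aut_embed: "frac_extend \<iota> f (\<iota> a) = \<iota> (f a)"
    and frac_aut_scale: "frac_extend \<iota> f (frac_scale \<iota> d u) = frac_scale \<iota> d (frac_extend \<iota> f u)"
proof -
  have f: "bij f" "f 1 = 1" "f (a + b) = f a + f b" "f (a * b) = f a * f b"
      "f (skew_scale d a) = skew_scale d (f a)" for a b d
    using assms by (auto simp: skew_automorphism_def skew_linear_iff)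
  note F = frac_extend[of f, OF f(1-4)]
  show "frac_extend \<iota> f 1 = 1"
    and "frac_extend \<iota> f (u + v) = frac_extend \<iota> f u + frac_extend \<iota> f v"
    and "frac_extend \<iota> f (u * v) = frac_extend \<iota> f u * frac_extend \<iota> f v"
    and "frac_extend \<iota> f (\<iota> a) = \<iota> (f a)" for u v a
    by (rule F)+
  show "frac_extend \<iota> f (frac_scale \<iota> d u) = frac_scale \<iota> d (frac_extend \<iota> f u)" for d u
    unfolding frac_scale_def by (simp add: F(4,5) f)
qed

section \<open>Composition of automorphisms and the vanishing principle\<close>

lemma skew_automorphism_comp:
  assumes "skew_automorphism f" "skew_automorphism g"
  shows "skew_automorphism (f \<circ> g)"
  using assms by (auto simp: skew_automorphism_def skew_linear_iff intro: bij_comp)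

lemma frac_extend_comp:
  assumes "skew_automorphism f" "skew_automorphism g"
  shows "frac_extend \<iota> (f \<circ> g) u = frac_extend \<iota> f (frac_extend \<iota> g u)"
proof -
  have "bij (frac_extend \<iota> h)" if "skew_automorphism h" for h
    using that by (intro frac_extend_bij) (auto simp: skew_automorphism_def skew_linear_iff)
  then have "bij (frac_extend \<iota> f \<circ> frac_extend \<iota> g)" using assms by (blast intro: bij_comp)
  then have "frac_extend \<iota> (f \<circ> g) = frac_extend \<iota> f \<circ> frac_extend \<iota> g"
    by (rule frac_extend_unique) (simp_all add: frac_aut[OF assms(1)] frac_aut[OF assms(2)])
  then show ?thesis by simp
qed

text \<open>Two composites of automorphisms that agree on generators agree on the algebra, and
  extension to fractions respects composition.\<close>

lemma frac_extend_intertwine: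
  assumes "skew_automorphism f" "skew_automorphism g" "skew_automorphism h"
    and "\<And>k. f (g (skew_var k)) = h (f (skew_var k))"
  shows "frac_extend \<iota> f (frac_extend \<iota> g u) = frac_extend \<iota> h (frac_extend \<iota> f u)"
proof -
  have "(f \<circ> g) p = (h \<circ> f) p" for p
    by (rule skew_hom_eqI[where f = "f \<circ> g" and g = "h \<circ> f"])
       (use assms skew_automorphism_comp[OF assms(1,2)] skew_automorphism_comp[OF assms(3,1)]
         in \<open>auto simp: skew_automorphism_def\<close>)
  then have "f \<circ> g = h \<circ> f" by blast
  then show ?thesis using frac_extend_comp assms by metis
qed

lemma skew_automorphism_eq_0_iff:
  assumes "skew_automorphism f"
  shows "f p = 0 \<longleftrightarrow> p = 0"
proof -
  have "f 0 = 0" using assms by (metis skew.scale_zero_left skew_automorphism_def skew_linear_iff)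
  moreover have "inj f" using assms by (simp add: skew_automorphism_def bij_is_inj)
  ultimately show ?thesis by (metis injD)
qed

text \<open>Pulling out polynomials gives \<open>T a = f(a) T 1 = 0\<close>; then
  \<open>b u = a\<close> yields \<open>f(b) T u = 0\<close> with \<open>f(b)\<close> nonzero.
  Operator identities thereby reduce to a rule on generators.\<close>

lemma twisted_linear_eq_0:
  assumes T: "Vector_Spaces.linear (frac_scale \<iota>) (frac_scale \<iota>) T" "T 1 = 0"
    and f: "skew_automorphism f"
    and twist: "\<And>k u. T (\<iota> (skew_var k) * u) = \<iota> (f (skew_var k)) * T u"
  shows "T u = 0"
proof -
  have fS: "f 1 = 1" "f (a + b) = f a + f b" "f (a * b) = f a * f b"
      "f (skew_scale d a) = skew_scale d (f a)" for a b d
    using f by (auto simp: skew_automorphism_def skew_linear_iff)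
  have T': "T (u + v) = T u + T v" "T (frac_scale \<iota> c u) = frac_scale \<iota> c (T u)" for u v c
    using T by (auto simp: frac_linear_iff)
  have *: "T (\<iota> p * u) = \<iota> (f p) * T u" for p u
  proof (induction p arbitrary: u rule: skew_poly_induct)
    case (var i p)
    then show ?case using twist[of i "\<iota> p * u"] by (simp add: embed_mult fS mult.assoc)
  qed (simp_all add: embed_one embed_scale embed_add fS T' ring_distribs)
  obtain a b where ab: "b \<noteq> 0" "\<iota> b * u = \<iota> a" by (rule left_fraction)
  have "\<iota> (f b) * T u = 0" using *[of b u] *[of a 1] by (simp add: ab(2) T(2))
  then show ?thesis using ab(1) skew_automorphism_eq_0_iff[OF f] by simp
qed

section \<open>Divided differences\<close>

definition divided_difference :: "complex \<Rightarrow> 'n \<Rightarrow> 'n \<Rightarrow> 'k \<Rightarrow> 'k"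
  where "divided_difference \<epsilon> i j u =
    \<iota> (skew_var i + skew_scale \<epsilon> (skew_var j)) /
    \<iota> (skew_var i ^ 2 - skew_scale (\<epsilon> ^ 2) (skew_var j ^ 2)) *
    (u - frac_extend \<iota> (skew_sigma \<epsilon> i j) u)"

section \<open>The central denominators\<close>

lemma embed_var_anticommute:
  assumes "i \<noteq> j"
  shows "\<iota> (skew_var i) * \<iota> (skew_var j) = - (\<iota> (skew_var j) * \<iota> (skew_var i))"
    "\<iota> (skew_var i) * (\<iota> (skew_var j) * u) = - (\<iota> (skew_var j) * (\<iota> (skew_var i) * u))"
proof -
  show 1: "\<iota> (skew_var i) * \<iota> (skew_var j) = - (\<iota> (skew_var j) * \<iota> (skew_var i))"
    using skew_var_anticommute[OF assms] by (simp flip: embed_mult embed_uminus)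
  show "\<iota> (skew_var i) * (\<iota> (skew_var j) * u) = - (\<iota> (skew_var j) * (\<iota> (skew_var i) * u))"
    by (simp add: 1 flip: mult.assoc)
qed

lemma skew_partial_scale: "skew_partial i (skew_scale d p) = skew_scale d (skew_partial i p)"
  using skew_partial_linear[of i] by (simp add: skew_linear_iff)

lemma skew_var_nonzero: "skew_var (i :: 'n) \<noteq> 0"
proof
  assume "skew_var i = 0"
  \<comment> \<open>Zero is written as a scalar multiple so that homogeneity of the derivative
    applies.\<close>
  then have "skew_partial i (skew_scale 0 1) = 1" by (metis skew.scale_zero_left skew_partial_var)
  then show False by (subst (asm) skew_partial_scale) simp
qed

text \<open>The derivative in direction \<open>i\<close> kills \<open>x_j^2\<close> but sends
  \<open>x_i^2\<close> to \<open>2 x_i\<close>, since \<open>\<gamma>_i\<close> fixes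
  \<open>x_i\<close>.\<close>

lemma denominator_nonzero:
  fixes i j :: 'n
  assumes "i \<noteq> j"
  shows "skew_var i ^ 2 - skew_scale e (skew_var j ^ 2) \<noteq> 0"
proof
  assume "skew_var i ^ 2 - skew_scale e (skew_var j ^ 2) = 0"
  then have "skew_partial i (skew_var i ^ 2) = skew_partial i (skew_scale e (skew_var j ^ 2))"
    by simp
  then have "skew_var i + skew_var i = 0"
    using assms by (simp add: power2_eq_square skew_partial_scale skew_partial_mult
        skew_partial_var skew_gamma)
  then have "skew_scale 2 (skew_var i) = 0"
    using skew.scale_left_distrib[of 1 1 "skew_var i"] by simp
  then show False using skew_var_nonzero by simp
qed

text \<open>Commutation spreads from generators to polynomials and, by clearing a denominator, to
  fractions. The case \<open>v = 0\<close> rests on \<open>inverse 0 = 0\<close>.\<close>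

lemma inverse_central:
  fixes v :: 'k
  assumes "\<And>k. \<iota> (skew_var k) * v = v * \<iota> (skew_var k)"
  shows "inverse v * u = u * inverse v"
proof -
  have p: "\<iota> p * v = v * \<iota> p" for p
  proof (induction p rule: skew_poly_induct)
    case (var i p)
    then show ?case using assms[of i] by (simp add: embed_mult) (metis mult.assoc)
  qed (simp_all add: embed_one embed_scale embed_add ring_distribs)
  obtain a b where ab: "b \<noteq> 0" "u * \<iota> b = \<iota> a" by (rule fraction_mult)
  have "u * v * \<iota> b = v * u * \<iota> b" by (metis ab(2) mult.assoc p)
  then have "u * v = v * u" using ab(1) by simp
  then show ?thesis
    by (cases "v = 0") (simp, metis mult.assoc left_inverse mult_1_left mult_1_right right_inverse)
qed

lemma divided_difference_central:
  fixes \<epsilon> :: complex and i j :: 'n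
  assumes "i \<noteq> j"
  defines "e \<equiv> inverse (\<iota> (skew_var i ^ 2 - skew_scale (\<epsilon> ^ 2) (skew_var j ^ 2)))"
  shows "u * (e * v) = e * (u * v)"
    and "v = e * (\<iota> (skew_var i) * (\<iota> (skew_var i) * v) -
      frac_scale \<iota> (\<epsilon> ^ 2) (\<iota> (skew_var j) * (\<iota> (skew_var j) * v)))"
    and "divided_difference \<epsilon> i j v =
      e * ((\<iota> (skew_var i) + frac_scale \<iota> \<epsilon> (\<iota> (skew_var j))) *
        (v - frac_extend \<iota> (skew_sigma \<epsilon> i j) v))"
proof -
  \<comment> \<open>Moving a generator past a square costs two sign changes, so squares of
    generators are central.\<close>
  have sq: "\<iota> (skew_var k) * (\<iota> (skew_var l) * \<iota> (skew_var l)) =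
      \<iota> (skew_var l) * (\<iota> (skew_var l) * \<iota> (skew_var k))" for k l
    by (cases "k = l") (simp_all add: embed_var_anticommute[of k l])
  have e: "e * u = u * e" for u
    unfolding e_def
    by (rule inverse_central)
       (simp only: embed_diff embed_scale embed_mult power2_eq_square left_diff_distrib
         right_diff_distrib mult.assoc frac_scale_mult, metis sq)
  show "u * (e * v) = e * (u * v)" by (metis e mult.assoc)
  have "\<iota> (skew_var i) * (\<iota> (skew_var i) * v) -
      frac_scale \<iota> (\<epsilon> ^ 2) (\<iota> (skew_var j) * (\<iota> (skew_var j) * v)) =
      \<iota> (skew_var i ^ 2 - skew_scale (\<epsilon> ^ 2) (skew_var j ^ 2)) * v"
    by (simp add: embed_diff embed_scale embed_mult power2_eq_square left_diff_distrib mult.assoc)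
  then show "v = e * (\<iota> (skew_var i) * (\<iota> (skew_var i) * v) -
      frac_scale \<iota> (\<epsilon> ^ 2) (\<iota> (skew_var j) * (\<iota> (skew_var j) * v)))"
    using denominator_nonzero[OF assms(1)] by (simp add: e_def flip: mult.assoc)
  show "divided_difference \<epsilon> i j v =
      e * ((\<iota> (skew_var i) + frac_scale \<iota> \<epsilon> (\<iota> (skew_var j))) *
        (v - frac_extend \<iota> (skew_sigma \<epsilon> i j) v))"
    unfolding divided_difference_def divide_inverse e_def[symmetric] e[symmetric]
    by (simp add: embed_add embed_scale mult.assoc)
qed

section \<open>Moving a generator past the summands of a Dunkl operator\<close>

lemmas frac_simps = ring_distribs mult.assoc frac.scale_right_distrib frac.scale_right_diff_distrib
  frac.scale_left_distrib frac.scale_left_diff_distrib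

lemma sigma_var:
  assumes "\<epsilon> \<noteq> 0" "i \<noteq> j"
  shows "frac_extend \<iota> (skew_sigma \<epsilon> i j) (\<iota> (skew_var k) * u) =
    (if k = i then frac_scale \<iota> \<epsilon> (\<iota> (skew_var j) * frac_extend \<iota> (skew_sigma \<epsilon> i j) u)
     else if k = j then
       frac_scale \<iota> (- inverse \<epsilon>) (\<iota> (skew_var i) * frac_extend \<iota> (skew_sigma \<epsilon> i j) u)
     else \<iota> (skew_var k) * frac_extend \<iota> (skew_sigma \<epsilon> i j) u)"
  using skew_sigma[OF assms] by (simp add: frac_aut embed_scale embed_uminus)

text \<open>Put \<open>N = x_i + \<epsilon> x_j\<close>. In the first case
  \<open>x_i N - \<epsilon> N x_j\<close> equals the denominator, so \<sigma> appears without a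
  fraction, and \<open>N x_i - x_i N = 2 \<epsilon> x_j x_i\<close> gives the last term. The second
  case uses \<open>N x_j + x_j N = 2 \<epsilon> x_j^2\<close>. Any other generator anticommutes with
  \<open>N\<close>.\<close>

lemma divided_difference_var:
  fixes \<epsilon> :: complex and i j :: 'n
  assumes "\<epsilon> \<noteq> 0" "i \<noteq> j"
  defines "e \<equiv> inverse (\<iota> (skew_var i ^ 2 - skew_scale (\<epsilon> ^ 2) (skew_var j ^ 2)))"
  shows "divided_difference \<epsilon> i j (\<iota> (skew_var i) * u) =
      \<iota> (skew_var i) * divided_difference \<epsilon> i j u + frac_extend \<iota> (skew_sigma \<epsilon> i j) u +
      frac_scale \<iota> \<epsilon> (e * (frac_scale \<iota> 2 (\<iota> (skew_var j) * (\<iota> (skew_var i) * u))))"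
    and "divided_difference \<epsilon> i j (\<iota> (skew_var j) * u) =
      - \<iota> (skew_var j) * divided_difference \<epsilon> i j u +
      frac_scale \<iota> (inverse \<epsilon>) (frac_extend \<iota> (skew_sigma \<epsilon> i j) u) +
      frac_scale \<iota> \<epsilon> (e * (frac_scale \<iota> 2 (\<iota> (skew_var j) * (\<iota> (skew_var j) * u))))"
    and "k \<noteq> i \<Longrightarrow> k \<noteq> j \<Longrightarrow> divided_difference \<epsilon> i j (\<iota> (skew_var k) * u) =
      - \<iota> (skew_var k) * divided_difference \<epsilon> i j u"
proof -
  let ?S = "frac_extend \<iota> (skew_sigma \<epsilon> i j)" and ?x = "\<lambda>k. \<iota> (skew_var k)"
  note e = divided_difference_central[OF assms(2), where \<epsilon> = \<epsilon>, folded e_def]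
  have two: "frac_scale \<iota> 2 v = v + v" for v
    using frac.scale_left_distrib[of 1 1 v] by simp
  \<comment> \<open>Oriented so as to eliminate \<open>x_i^2\<close> over the denominator, which
    brings both sides to the same form.\<close>
  have D: "e * (?x i * (?x i * v)) = v + e * frac_scale \<iota> (\<epsilon> ^ 2) (?x j * (?x j * v))" for v
    using e(2)[of v] unfolding right_diff_distrib by (simp only: eq_diff_eq)
  show "divided_difference \<epsilon> i j (?x i * u) =
      ?x i * divided_difference \<epsilon> i j u + ?S u +
      frac_scale \<iota> \<epsilon> (e * (frac_scale \<iota> 2 (?x j * (?x i * u))))"
    unfolding e(3) e(1) sigma_var[OF assms(1,2)]
    using assms(1,2) embed_var_anticommute(2)[of i j] D[of "?S u"]
    by (simp add: frac_simps two power2_eq_square)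
  show "divided_difference \<epsilon> i j (?x j * u) =
      - ?x j * divided_difference \<epsilon> i j u + frac_scale \<iota> (inverse \<epsilon>) (?S u) +
      frac_scale \<iota> \<epsilon> (e * (frac_scale \<iota> 2 (?x j * (?x j * u))))"
    unfolding e(3) e(1) sigma_var[OF assms(1,2)]
    using assms(1,2) embed_var_anticommute(2)[of i j] D[of "?S u"]
    by (simp add: frac_simps two power2_eq_square)
  show "divided_difference \<epsilon> i j (?x k * u) = - ?x k * divided_difference \<epsilon> i j u"
    if "k \<noteq> i" "k \<noteq> j"
    unfolding e(3) e(1) sigma_var[OF assms(1,2)]
    using that embed_var_anticommute(2)[of i k] embed_var_anticommute(2)[of j k] e(1)[of "?x k"]
    by (simp add: frac_simps)
qed

lemma frac_partial_var:
  "frac_partial \<iota> i (\<iota> (skew_var k) * u) =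
    (if k = i then u else 0) + \<iota> (skew_gamma i (skew_var k)) * frac_partial \<iota> i u"
  by (simp add: frac_partial_mult frac_partial_embed skew_field_of_fractions_axioms
      skew_partial_var frac_aut_embed skew_gamma(1) embed_one)

text \<open>The definition of \<open>frac_partial\<close> asks only for additivity; homogeneity
  follows from the Leibniz rule, as scalars are fixed by \<open>\<gamma>_i\<close> and have
  derivative zero.\<close>

lemma frac_partial_scale:
  "frac_partial \<iota> i (frac_scale \<iota> d u) = frac_scale \<iota> d (frac_partial \<iota> i u)"
proof -
  have "skew_gamma i (skew_scale d 1) = skew_scale d 1"
    using skew_gamma(1)[of i] by (simp add: skew_automorphism_def skew_linear_iff)
  then show ?thesis
    unfolding frac_scale_def
    by (simp add: frac_partial_mult frac_partial_embed skew_field_of_fractions_axioms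
        skew_partial_scale skew_partial_one frac_aut_embed skew_gamma(1))
qed

lemma divided_difference_linear:
  assumes "\<epsilon> \<noteq> 0" "i \<noteq> j"
  shows "divided_difference \<epsilon> i j (u + v) = divided_difference \<epsilon> i j u + divided_difference \<epsilon> i j v"
    and "divided_difference \<epsilon> i j (frac_scale \<iota> d u) = frac_scale \<iota> d (divided_difference \<epsilon> i j u)"
    and "divided_difference \<epsilon> i j 1 = 0"
  using skew_sigma(1)[OF assms]
  by (simp_all add: divided_difference_def frac_aut add_diff_add ring_distribs
      flip: frac.scale_right_diff_distrib)

text \<open>For \<open>k = i\<close> this is \<open>u - \<epsilon> \<tau> u = (u - \<tau> u) + (1 -
  \<epsilon>) \<tau> u\<close>; the factor \<open>1 - \<epsilon>\<close> will cancel the denominator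
  of the coefficient. Otherwise \<open>x_k\<close> anticommutes with the inverse of
  \<open>x_i\<close>.\<close>

lemma t_difference_var:
  assumes "\<epsilon> \<noteq> 0"
  shows "1 / \<iota> (skew_var i) * (\<iota> (skew_var k) * u - frac_extend \<iota> (skew_t \<epsilon> i) (\<iota> (skew_var k) * u)) =
    \<iota> (skew_gamma i (skew_var k)) * (1 / \<iota> (skew_var i) * (u - frac_extend \<iota> (skew_t \<epsilon> i) u)) +
    (if k = i then frac_scale \<iota> (1 - \<epsilon>) (frac_extend \<iota> (skew_t \<epsilon> i) u) else 0)"
proof -
  let ?x = "\<iota> (skew_var i)" and ?T = "frac_extend \<iota> (skew_t \<epsilon> i)"
  have x: "?x \<noteq> 0" using skew_var_nonzero by simp
  then have cancel: "?x * (inverse ?x * v) = v" "inverse ?x * (?x * v) = v" for v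
    by (simp_all flip: mult.assoc)
  show ?thesis
  proof (cases "k = i")
    case True
    then show ?thesis
      using skew_t[OF assms, of i]
      by (simp add: frac_aut embed_scale divide_inverse cancel right_diff_distrib skew_gamma
          frac.scale_left_diff_distrib)
  next
    case False
    have "?x * (inverse ?x * (\<iota> (skew_var k) * v)) = ?x * - (\<iota> (skew_var k) * (inverse ?x * v))" for v
      using embed_var_anticommute(2)[of k i "inverse ?x * v"] False by (simp add: cancel)
    then have "inverse ?x * (\<iota> (skew_var k) * v) = - (\<iota> (skew_var k) * (inverse ?x * v))" for v
      using x by (metis mult_left_cancel)
    then show ?thesis
      using False skew_t[OF assms, of i]
      by (simp add: frac_aut divide_inverse right_diff_distrib skew_gamma embed_uminus)
  qed
qed

end

section \<open>Commutation relations of the Dunkl operators\<close>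

locale braided_dunkl = skew_poly_fractions \<iota>
  for \<iota> :: "'n::{finite,linorder} skew_poly \<Rightarrow> 'k::division_ring" +
  fixes C C' :: "complex set" and c :: "complex \<Rightarrow> complex"
  assumes C_group: "subgroup C complex_units"
    and C_minus_one: "- 1 \<in> C" and C'_subset: "C' \<subseteq> C"
begin

abbreviation "\<sigma> \<epsilon> i j \<equiv> frac_extend \<iota> (skew_sigma \<epsilon> i j)"
abbreviation "\<tau> \<epsilon> i \<equiv> frac_extend \<iota> (skew_t \<epsilon> i)"
abbreviation "nabla \<equiv> braided_nabla \<iota> C C' c"

lemma C_nonzero: "\<epsilon> \<in> C \<Longrightarrow> \<epsilon> \<noteq> 0"
  using subgroup.subset[OF C_group] by (auto simp: complex_units_def)

lemma C_closed:
  "1 \<in> C" "\<epsilon> \<in> C \<Longrightarrow> \<eta> \<in> C \<Longrightarrow> \<epsilon> * \<eta> \<in> C" "\<epsilon> \<in> C \<Longrightarrow> - \<epsilon> \<in> C" "\<epsilon> \<in> C \<Longrightarrow> inverse \<epsilon> \<in> C"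
proof -
  show "1 \<in> C" using subgroup.one_closed[OF C_group] by (simp add: complex_units_def)
  show m: "\<epsilon> \<in> C \<Longrightarrow> \<eta> \<in> C \<Longrightarrow> \<epsilon> * \<eta> \<in> C" for \<epsilon> \<eta>
    using subgroup.m_closed[OF C_group, of \<epsilon> \<eta>] by (simp add: complex_units_def)
  show "\<epsilon> \<in> C \<Longrightarrow> - \<epsilon> \<in> C" using m[OF C_minus_one, of \<epsilon>] by simp
  show "inverse \<epsilon> \<in> C" if "\<epsilon> \<in> C"
  proof -
    interpret U: group complex_units by (rule group_complex_units)
    have "inv\<^bsub>complex_units\<^esub> \<epsilon> = inverse \<epsilon>"
      by (rule U.inv_equality) (use C_nonzero[OF that] in \<open>auto simp: complex_units_def\<close>)
    then show ?thesis using subgroup.m_inv_closed[OF C_group that] by simp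
  qed
qed

section \<open>Translation and parity in sums over the group \<open>C\<close>\<close>

lemma sum_C_translate:
  fixes g :: "complex \<Rightarrow> 'b::comm_monoid_add"
  assumes "a \<in> C"
  shows "(\<Sum>\<epsilon>\<in>C. g (\<epsilon> * a)) = (\<Sum>\<epsilon>\<in>C. g \<epsilon>)"
  by (rule sum.reindex_bij_witness[where i = "\<lambda>\<epsilon>. \<epsilon> * inverse a" and j = "\<lambda>\<epsilon>. \<epsilon> * a"])
     (use assms C_nonzero in \<open>auto intro!: C_closed simp: mult.assoc\<close>)

text \<open>Translation by \<open>- 1\<close> shows that the sum is its own negative, and 2 is
  invertible as a complex scalar.\<close>

lemma sum_C_odd:
  assumes "\<And>\<epsilon>. \<epsilon> \<in> C \<Longrightarrow> g (- \<epsilon>) = - g \<epsilon>"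
  shows "(\<Sum>\<epsilon>\<in>C. g \<epsilon>) = (0 :: 'k)"
proof -
  have "(\<Sum>\<epsilon>\<in>C. g \<epsilon>) = (\<Sum>\<epsilon>\<in>C. g (\<epsilon> * - 1))"
    by (rule sum_C_translate[OF C_minus_one, symmetric])
  also have "\<dots> = - (\<Sum>\<epsilon>\<in>C. g \<epsilon>)" using assms by (simp add: sum_negf)
  finally have "frac_scale \<iota> 2 (\<Sum>\<epsilon>\<in>C. g \<epsilon>) = 0"
    using frac.scale_left_distrib[of 1 1 "\<Sum>\<epsilon>\<in>C. g \<epsilon>"] by (simp add: eq_neg_iff_add_eq_0)
  then show ?thesis by simp
qed

text \<open>Moving a generator past a single divided difference leaves, besides a group element, a
  rational function odd in \<open>\<epsilon>\<close>; since \<open>- 1 \<in> C\<close>, these cancel in the sum.\<close>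

lemma sum_divided_difference_var:
  assumes "j \<noteq> i"
  shows "(\<Sum>\<epsilon>\<in>C. divided_difference \<epsilon> i j (\<iota> (skew_var k) * u)) =
    \<iota> (skew_gamma i (skew_var k)) * (\<Sum>\<epsilon>\<in>C. divided_difference \<epsilon> i j u) +
    (if k = i then \<Sum>\<epsilon>\<in>C. \<sigma> \<epsilon> i j u
     else if k = j then \<Sum>\<epsilon>\<in>C. frac_scale \<iota> (inverse \<epsilon>) (\<sigma> \<epsilon> i j u) else 0)"
proof -
  \<comment> \<open>The denominator depends only on \<open>\<epsilon>^2\<close>, so the prefactor
    makes the term odd. Here \<open>w\<close> is a multiple of \<open>u\<close> by
    \<open>x_j x_i\<close> or \<open>x_j^2\<close>.\<close>
  have odd: "(\<Sum>\<epsilon>\<in>C. frac_scale \<iota> (\<epsilon> * 2)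
      (inverse (\<iota> (skew_var i ^ 2 - skew_scale (\<epsilon> ^ 2) (skew_var j ^ 2))) * w)) = 0" for w
    by (rule sum_C_odd) simp
  consider "k = i" | "k = j" | "k \<noteq> i" "k \<noteq> j" by blast
  then show ?thesis
  proof cases
    case 1
    then show ?thesis
      using assms odd
      by (simp add: divided_difference_var C_nonzero sum.distrib skew_gamma sum_distrib_left
          cong: sum.cong_simp)
  next
    case 2
    then show ?thesis
      using assms odd
      by (simp add: divided_difference_var C_nonzero sum.distrib skew_gamma sum_distrib_left
          embed_uminus sum_subtractf sum_negf cong: sum.cong_simp)
  next
    case 3
    then show ?thesis
      using assms
      by (simp add: divided_difference_var C_nonzero skew_gamma sum_distrib_left
          embed_uminus cong: sum.cong_simp)
  qed
qed

text \<open>The operator \<open>A\<^sub>i\<^sub>k\<close>: the remainder left when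
  \<open>x_k\<close> passes \<open>nabla i\<close>. It is free of denominators in the
  generators.\<close>

definition nabla_bracket :: "'n \<Rightarrow> 'n \<Rightarrow> 'k \<Rightarrow> 'k"
  where "nabla_bracket i k u = (if k = i
    then u + frac_scale \<iota> (c 1) (\<Sum>j\<in>UNIV - {i}. \<Sum>\<epsilon>\<in>C. \<sigma> \<epsilon> i j u) +
      (\<Sum>\<epsilon>'\<in>C' - {1}. frac_scale \<iota> (c \<epsilon>') (\<tau> \<epsilon>' i u))
    else frac_scale \<iota> (c 1) (\<Sum>\<epsilon>\<in>C. frac_scale \<iota> (inverse \<epsilon>) (\<sigma> \<epsilon> i k u)))"

lemma nabla_eq:
  "nabla i u = frac_partial \<iota> i u +
    frac_scale \<iota> (c 1) (\<Sum>j\<in>UNIV - {i}. \<Sum>\<epsilon>\<in>C. divided_difference \<epsilon> i j u) +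
    (\<Sum>\<epsilon>'\<in>C' - {1}. frac_scale \<iota> (c \<epsilon>' / (1 - \<epsilon>')) (1 / \<iota> (skew_var i) * (u - \<tau> \<epsilon>' i u)))"
  by (simp add: braided_nabla_def divided_difference_def)

text \<open>All three parts of the operator let \<open>x_k\<close> pass with the same twist
  \<open>\<gamma>_i\<close>, so their remainders add up.\<close>

lemma nabla_var:
  "nabla i (\<iota> (skew_var k) * u) = \<iota> (skew_gamma i (skew_var k)) * nabla i u + nabla_bracket i k u"
proof -
  let ?g = "\<iota> (skew_gamma i (skew_var k))"
  \<comment> \<open>For \<open>k \<noteq> i\<close> only the summand \<open>j = k\<close> of the
    outer sum leaves a remainder.\<close>
  have refl: "(\<Sum>j\<in>UNIV - {i}. \<Sum>\<epsilon>\<in>C. divided_difference \<epsilon> i j (\<iota> (skew_var k) * u)) =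
    ?g * (\<Sum>j\<in>UNIV - {i}. \<Sum>\<epsilon>\<in>C. divided_difference \<epsilon> i j u) +
    (if k = i then \<Sum>j\<in>UNIV - {i}. \<Sum>\<epsilon>\<in>C. \<sigma> \<epsilon> i j u
     else \<Sum>\<epsilon>\<in>C. frac_scale \<iota> (inverse \<epsilon>) (\<sigma> \<epsilon> i k u))"
    using sum_divided_difference_var[of _ i k u]
    by (auto simp: sum.distrib sum_distrib_left cong: sum.cong_simp)
  have nz: "\<epsilon>' \<noteq> 0" "1 - \<epsilon>' \<noteq> 0" if "\<epsilon>' \<in> C' - {1}" for \<epsilon>'
    using that C'_subset C_nonzero by auto
  have "(\<Sum>\<epsilon>'\<in>C' - {1}. frac_scale \<iota> (c \<epsilon>' / (1 - \<epsilon>'))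
      (1 / \<iota> (skew_var i) * (\<iota> (skew_var k) * u - \<tau> \<epsilon>' i (\<iota> (skew_var k) * u)))) =
    ?g * (\<Sum>\<epsilon>'\<in>C' - {1}. frac_scale \<iota> (c \<epsilon>' / (1 - \<epsilon>')) (1 / \<iota> (skew_var i) * (u - \<tau> \<epsilon>' i u))) +
    (if k = i then \<Sum>\<epsilon>'\<in>C' - {1}. frac_scale \<iota> (c \<epsilon>') (\<tau> \<epsilon>' i u) else 0)" (is "sum ?l _ = _ * sum ?r _ + _")
  proof -
    have "?l \<epsilon>' = ?g * ?r \<epsilon>' + (if k = i then frac_scale \<iota> (c \<epsilon>') (\<tau> \<epsilon>' i u) else 0)"
      if "\<epsilon>' \<in> C' - {1}" for \<epsilon>'
      unfolding t_difference_var[OF nz(1)[OF that]]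
      using nz(2)[OF that] by (simp add: frac.scale_right_distrib)
    then show ?thesis by (simp add: sum.distrib sum_distrib_left cong: sum.cong_simp)
  qed
  then show ?thesis
    unfolding nabla_eq refl frac_partial_var nabla_bracket_def
    by (simp add: ring_distribs frac.scale_right_distrib add_ac)
qed

lemma nabla_linear:
  "nabla i (u + v) = nabla i u + nabla i v" "nabla i (frac_scale \<iota> d u) = frac_scale \<iota> d (nabla i u)" "nabla i 1 = 0"
proof -
  have t: "\<tau> \<epsilon>' i (u + v) = \<tau> \<epsilon>' i u + \<tau> \<epsilon>' i v" "\<tau> \<epsilon>' i (frac_scale \<iota> d u) = frac_scale \<iota> d (\<tau> \<epsilon>' i u)"
    "\<tau> \<epsilon>' i 1 = 1"
    if "\<epsilon>' \<in> C' - {1}" for \<epsilon>' u v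
    using that C'_subset C_nonzero skew_t(1)[of \<epsilon>' i] by (auto simp: frac_aut)
  have "frac_partial \<iota> i 1 = 0"
    using frac_partial_embed[OF skew_field_of_fractions_axioms, of i 1]
    by (simp add: embed_one skew_partial_one)
  then show "nabla i 1 = 0"
    by (simp add: nabla_eq divided_difference_linear C_nonzero t cong: sum.cong_simp)
  show "nabla i (u + v) = nabla i u + nabla i v"
    by (simp add: nabla_eq divided_difference_linear C_nonzero t frac_simps add_diff_add sum.distrib
        frac_partial_add skew_field_of_fractions_axioms add_ac cong: sum.cong_simp)
  show "nabla i (frac_scale \<iota> d u) = frac_scale \<iota> d (nabla i u)"
    by (simp add: nabla_eq divided_difference_linear C_nonzero t frac.scale_right_distrib
        frac.scale_sum_right frac_partial_scale mult.left_commute[of _ d] mult.commute[of d]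
        frac.scale_right_diff_distrib right_diff_distrib cong: sum.cong_simp)
qed

lemma nabla_diff: "nabla i (- u) = - nabla i u" "nabla i (u - v) = nabla i u - nabla i v"
proof -
  show neg: "nabla i (- u) = - nabla i u" for u
    using nabla_linear(2)[of i "- 1" u] by simp
  show "nabla i (u - v) = nabla i u - nabla i v"
    using nabla_linear(1)[of i u "- v"] by (simp add: neg)
qed

lemma nabla_sum: "nabla i (sum g A) = (\<Sum>a\<in>A. nabla i (g a))"
proof (induction A rule: infinite_finite_induct)
  case (insert a A)
  then show ?case by (simp add: nabla_linear)
qed (use nabla_linear(2)[of i 0] in simp_all)

lemma frac_aut_sum:
  assumes "skew_automorphism f"
  shows "frac_extend \<iota> f (sum g A) = (\<Sum>a\<in>A. frac_extend \<iota> f (g a))"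
proof -
  have "frac_extend \<iota> f 0 = 0"
    using frac_aut_scale[OF assms, of 0 0] by simp
  then show ?thesis
    by (induction A rule: infinite_finite_induct) (simp_all add: frac_aut_add[OF assms])
qed

lemma nabla_preserves: "nabla i (\<iota> p) \<in> range \<iota>"
proof -
  have plus: "u + v \<in> range \<iota>" if "u \<in> range \<iota>" "v \<in> range \<iota>" for u v
    using that by (auto simp flip: embed_add)
  have times: "u * v \<in> range \<iota>" if "u \<in> range \<iota>" "v \<in> range \<iota>" for u v
    using that by (auto simp flip: embed_mult)
  have scale: "frac_scale \<iota> d u \<in> range \<iota>" if "u \<in> range \<iota>" for d u
    using that by (auto simp flip: embed_scale)
  have sum: "sum g A \<in> range \<iota>" if "\<And>a. a \<in> A \<Longrightarrow> g a \<in> range \<iota>" for g :: "'b \<Rightarrow> 'k" and A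
    using that by (induction A rule: infinite_finite_induct)
      (auto intro: plus simp flip: embed_zero)
  have sig: "\<sigma> \<epsilon> i j (\<iota> p) \<in> range \<iota>" if "\<epsilon> \<in> C" "i \<noteq> j" for \<epsilon> i j p
    using that by (simp add: frac_aut_embed skew_sigma(1) C_nonzero)
  have tau: "\<tau> \<epsilon> i (\<iota> p) \<in> range \<iota>" if "\<epsilon> \<in> C'" for \<epsilon> i p
    using that C'_subset C_nonzero by (simp add: frac_aut_embed skew_t(1) subset_iff)
  have bracket: "nabla_bracket i k (\<iota> p) \<in> range \<iota>" for i k p
    unfolding nabla_bracket_def by (auto intro!: plus scale sum sig tau)
  show ?thesis
  proof (induction p rule: skew_poly_induct)
    case one
    then show ?case using embed_zero by (metis embed_one nabla_linear(3) rangeI)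
  next
    case (var k p)
    then show ?case
      unfolding embed_mult nabla_var by (intro plus times bracket) simp_all
  qed (auto simp: embed_scale embed_add nabla_linear intro: plus scale)
qed

section \<open>Equivariance and anticommutation\<close>

text \<open>Comparing both sides on \<open>x_i\<close> forces the new parameter. The monomial form
  of \<open>f\<close> covers the automorphisms \<open>t\<close> and \<sigma> at once.\<close>

lemma sigma_conjugate:
  assumes f: "skew_automorphism f" "\<And>k. f (skew_var k) = skew_scale (w k) (skew_var (\<pi> k))"
    and "inj \<pi>" "\<And>k. w k \<noteq> 0" "\<epsilon> \<noteq> 0" "i \<noteq> j"
  shows "frac_extend \<iota> f (\<sigma> \<epsilon> i j u) =
    \<sigma> (\<epsilon> * (w j / w i)) (\<pi> i) (\<pi> j) (frac_extend \<iota> f u)"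
proof (rule frac_extend_intertwine[OF f(1)])
  define \<eta> where "\<eta> = \<epsilon> * (w j / w i)"
  have ne: "\<eta> \<noteq> 0" "\<pi> i \<noteq> \<pi> j" using assms by (auto simp: \<eta>_def dest: injD)
  \<comment> \<open>These are the agreement of the two sides on \<open>x_i\<close> and on
    \<open>x_j\<close>.\<close>
  have \<eta>: "w i * \<eta> = w j * \<epsilon>" "w j * inverse \<eta> = w i * inverse \<epsilon>"
    using assms(4,5) by (simp_all add: \<eta>_def field_simps)
  have pi_eq: "\<pi> a = \<pi> b \<longleftrightarrow> a = b" for a b using \<open>inj \<pi>\<close> by (auto dest: injD)
  have scale: "g (skew_scale d p) = skew_scale d (g p)" "g (- p) = - g p"
    if "skew_automorphism g" for g d p
    using that by (auto simp: skew_automorphism_def skew_linear_iff intro: skew_linear_uminus)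
  note s = skew_sigma[OF assms(5,6)] and s' = skew_sigma[OF ne]
  show "skew_automorphism (skew_sigma \<epsilon> i j)"
    "skew_automorphism (skew_sigma (\<epsilon> * (w j / w i)) (\<pi> i) (\<pi> j))"
    using s(1) s'(1) by (simp_all add: \<eta>_def)
  show "f (skew_sigma \<epsilon> i j (skew_var k)) =
      skew_sigma (\<epsilon> * (w j / w i)) (\<pi> i) (\<pi> j) (f (skew_var k))" for k
    unfolding \<eta>_def[symmetric] using \<eta> \<open>i \<noteq> j\<close>
    by (simp add: s(2) s'(2) f(2) scale[OF f(1)] scale[OF s'(1)] pi_eq mult.commute)
qed

lemma t_conjugate:
  assumes f: "skew_automorphism f" "\<And>k. f (skew_var k) = skew_scale (w k) (skew_var (\<pi> k))"
    and "inj \<pi>" "\<epsilon> \<noteq> 0"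
  shows "frac_extend \<iota> f (\<tau> \<epsilon> i u) = \<tau> \<epsilon> (\<pi> i) (frac_extend \<iota> f u)"
proof (rule frac_extend_intertwine[OF f(1)])
  have pi_eq: "\<pi> a = \<pi> b \<longleftrightarrow> a = b" for a b using \<open>inj \<pi>\<close> by (auto dest: injD)
  have scale: "g (skew_scale d p) = skew_scale d (g p)" if "skew_automorphism g" for g d p
    using that by (simp add: skew_automorphism_def skew_linear_iff)
  note t = skew_t[OF assms(4)]
  show "skew_automorphism (skew_t \<epsilon> i)" "skew_automorphism (skew_t \<epsilon> (\<pi> i))"
    by (rule t)+
  show "f (skew_t \<epsilon> i (skew_var k)) = skew_t \<epsilon> (\<pi> i) (f (skew_var k))" for k
    by (simp add: t(2) f(2) scale[OF f(1)] scale[OF t(1)] pi_eq mult.commute)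
qed

text \<open>Conjugation multiplies the parameter by a quotient of weights, which lies in
  \<open>C\<close> and is absorbed by translating the sum. Off the diagonal the coefficient
  \<open>inverse \<epsilon>\<close> changes as well, which leaves the factor
  \<open>w k / w i\<close>.\<close>

lemma nabla_bracket_equivariant:
  assumes f: "skew_automorphism f" "\<And>k. f (skew_var k) = skew_scale (w k) (skew_var (\<pi> k))"
    and "inj \<pi>" "\<And>k. w k \<in> C"
  shows "frac_extend \<iota> f (nabla_bracket i k u) =
    frac_scale \<iota> (w k / w i) (nabla_bracket (\<pi> i) (\<pi> k) (frac_extend \<iota> f u))"
proof -
  let ?F = "frac_extend \<iota> f"
  have nz: "w k \<noteq> 0" for k using assms(4) C_nonzero by blast
  have pi_eq: "\<pi> a = \<pi> b \<longleftrightarrow> a = b" for a b using \<open>inj \<pi>\<close> by (auto dest: injD)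
  have quot: "w j / w i \<in> C" for j
    unfolding divide_inverse by (intro C_closed assms(4))
  note sig = sigma_conjugate[of f w \<pi>, OF f \<open>inj \<pi>\<close> nz C_nonzero]
  show ?thesis
  proof (cases "k = i")
    case True
    have "?F (\<Sum>\<epsilon>\<in>C. \<sigma> \<epsilon> i j u) = (\<Sum>\<epsilon>\<in>C. \<sigma> \<epsilon> (\<pi> i) (\<pi> j) (?F u))" if "i \<noteq> j" for j
    proof -
      have "?F (\<Sum>\<epsilon>\<in>C. \<sigma> \<epsilon> i j u) = (\<Sum>\<epsilon>\<in>C. \<sigma> (\<epsilon> * (w j / w i)) (\<pi> i) (\<pi> j) (?F u))"
        using sig that by (simp add: frac_aut_sum[OF f(1)] cong: sum.cong_simp)
      also have "\<dots> = (\<Sum>\<epsilon>\<in>C. \<sigma> \<epsilon> (\<pi> i) (\<pi> j) (?F u))"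
        by (rule sum_C_translate[OF quot])
      finally show ?thesis .
    qed
    then have "?F (\<Sum>j\<in>UNIV - {i}. \<Sum>\<epsilon>\<in>C. \<sigma> \<epsilon> i j u) =
        (\<Sum>j\<in>UNIV - {i}. \<Sum>\<epsilon>\<in>C. \<sigma> \<epsilon> (\<pi> i) (\<pi> j) (?F u))"
      unfolding frac_aut_sum[OF f(1), of _ "UNIV - {i}"] by (intro sum.cong) auto
    also have "\<dots> = (\<Sum>j\<in>\<pi> ` (UNIV - {i}). \<Sum>\<epsilon>\<in>C. \<sigma> \<epsilon> (\<pi> i) j (?F u))"
      using \<open>inj \<pi>\<close> by (simp add: sum.reindex inj_on_subset)
    \<comment> \<open>The index type is finite, so the injection is a permutation.\<close>
    also have "\<pi> ` (UNIV - {i}) = UNIV - {\<pi> i}"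
      using \<open>inj \<pi>\<close> by (simp add: image_set_diff finite_UNIV_inj_surj)
    finally have refl: "?F (\<Sum>j\<in>UNIV - {i}. \<Sum>\<epsilon>\<in>C. \<sigma> \<epsilon> i j u) =
        (\<Sum>j\<in>UNIV - {\<pi> i}. \<Sum>\<epsilon>\<in>C. \<sigma> \<epsilon> (\<pi> i) j (?F u))" .
    have "?F (\<Sum>\<epsilon>'\<in>C' - {1}. frac_scale \<iota> (c \<epsilon>') (\<tau> \<epsilon>' i u)) =
        (\<Sum>\<epsilon>'\<in>C' - {1}. frac_scale \<iota> (c \<epsilon>') (\<tau> \<epsilon>' (\<pi> i) (?F u)))"
      unfolding frac_aut_sum[OF f(1)] frac_aut_scale[OF f(1)]
      using C'_subset C_nonzero
      by (intro sum.cong arg_cong2[where f = "frac_scale \<iota>"] t_conjugate[OF f \<open>inj \<pi>\<close>]) auto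
    with True refl nz show ?thesis
      by (simp add: nabla_bracket_def frac_aut[OF f(1)])
  next
    case False
    have "?F (\<Sum>\<epsilon>\<in>C. frac_scale \<iota> (inverse \<epsilon>) (\<sigma> \<epsilon> i k u)) =
        (\<Sum>\<epsilon>\<in>C. frac_scale \<iota> (w k / w i * inverse (\<epsilon> * (w k / w i)))
          (\<sigma> (\<epsilon> * (w k / w i)) (\<pi> i) (\<pi> k) (?F u)))"
      using sig False nz
      by (simp add: frac_aut_sum[OF f(1)] frac_aut_scale[OF f(1)] inverse_eq_divide cong: sum.cong_simp)
    also have "\<dots> = (\<Sum>\<epsilon>\<in>C. frac_scale \<iota> (w k / w i * inverse \<epsilon>) (\<sigma> \<epsilon> (\<pi> i) (\<pi> k) (?F u)))"
      by (rule sum_C_translate[OF quot])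
    also have "\<dots> = frac_scale \<iota> (w k / w i)
        (\<Sum>\<epsilon>\<in>C. frac_scale \<iota> (inverse \<epsilon>) (\<sigma> \<epsilon> (\<pi> i) (\<pi> k) (?F u)))"
      by (simp add: frac.scale_sum_right)
    finally show ?thesis
      using False by (simp add: nabla_bracket_def pi_eq frac_aut[OF f(1)] mult.commute)
  qed
qed

text \<open>Both sides vanish at 1 and let a generator pass with the same twist and, by equivariance
  of the brackets, the same remainder. Their difference is therefore zero by the vanishing
  principle.\<close>

lemma nabla_equivariant:
  assumes f: "skew_automorphism f" "\<And>k. f (skew_var k) = skew_scale (w k) (skew_var (\<pi> k))"
    and "inj \<pi>" "\<And>k. w k \<in> C"
  shows "frac_extend \<iota> f (nabla i u) =
    frac_scale \<iota> (inverse (w i)) (nabla (\<pi> i) (frac_extend \<iota> f u))"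
proof -
  let ?F = "frac_extend \<iota> f"
  let ?T = "\<lambda>u. ?F (nabla i u) - frac_scale \<iota> (inverse (w i)) (nabla (\<pi> i) (?F u))"
  have nz: "w k \<noteq> 0" for k using assms(4) C_nonzero by blast
  have pi_eq: "\<pi> a = \<pi> b \<longleftrightarrow> a = b" for a b using \<open>inj \<pi>\<close> by (auto dest: injD)
  have neg: "f (- p) = - f p" for p
    using f(1) by (auto simp: skew_automorphism_def intro: skew_linear_uminus)
  have "?T u = 0"
  proof (rule twisted_linear_eq_0[where T = ?T and f = "f \<circ> skew_gamma i"])
    have "?F 0 = 0" using frac_aut_scale[OF f(1), of 0 0] by simp
    then show "?T 1 = 0" by (simp add: nabla_linear frac_aut_one[OF f(1)])
    show "Vector_Spaces.linear (frac_scale \<iota>) (frac_scale \<iota>) ?T"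
      by (simp add: frac_linear_iff frac_aut[OF f(1)] nabla_linear frac.scale_right_distrib
          frac.scale_right_diff_distrib mult.commute add_diff_add)
    show "skew_automorphism (f \<circ> skew_gamma i)"
      by (rule skew_automorphism_comp[OF f(1) skew_gamma(1)])
    show "?T (\<iota> (skew_var k) * u) = \<iota> ((f \<circ> skew_gamma i) (skew_var k)) * ?T u" for k u
    proof -
      \<comment> \<open>The signs agree because injectivity of \<open>\<pi>\<close> makes
        \<open>\<pi> k = \<pi> i\<close> equivalent to \<open>k = i\<close>.\<close>
      have g: "skew_scale (w k) (skew_gamma (\<pi> i) (skew_var (\<pi> k))) = f (skew_gamma i (skew_var k))"
        by (simp add: skew_gamma f(2) neg pi_eq)
      have "nabla (\<pi> i) (?F (\<iota> (skew_var k) * u)) =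
          \<iota> (f (skew_gamma i (skew_var k))) * nabla (\<pi> i) (?F u) +
          frac_scale \<iota> (w k) (nabla_bracket (\<pi> i) (\<pi> k) (?F u))"
        unfolding g[symmetric]
        by (simp add: frac_aut[OF f(1)] f(2) embed_scale nabla_linear nabla_var
            frac.scale_right_distrib)
      moreover have "?F (nabla i (\<iota> (skew_var k) * u)) =
          \<iota> (f (skew_gamma i (skew_var k))) * ?F (nabla i u) +
          frac_scale \<iota> (w k / w i) (nabla_bracket (\<pi> i) (\<pi> k) (?F u))"
        unfolding nabla_var frac_aut_add[OF f(1)] frac_aut_mult[OF f(1)] frac_aut_embed[OF f(1)]
        by (simp add: nabla_bracket_equivariant[OF f assms(3,4)])
      ultimately show ?thesis
        by (simp add: frac_simps divide_inverse mult.commute)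
    qed
  qed
  then show ?thesis by simp
qed

lemma t_nabla:
  assumes "\<epsilon> \<in> C" "k \<noteq> i"
  shows "\<tau> \<epsilon> k (nabla i u) = nabla i (\<tau> \<epsilon> k u)"
proof -
  let ?w = "\<lambda>l. if l = k then \<epsilon> else 1"
  have w: "?w l \<in> C" for l using assms(1) C_closed(1) by simp
  note t = skew_t[OF C_nonzero[OF assms(1)], of k]
  have "skew_t \<epsilon> k (skew_var l) = skew_scale (?w l) (skew_var (id l))" for l
    by (simp add: t(2))
  from nabla_equivariant[OF t(1) this inj_on_id w, of i u] show ?thesis
    using assms(2) by simp
qed

text \<open>Equivariance for a transposition with weights read off from \<sigma>; they lie in
  \<open>C\<close> because \<open>- 1 \<in> C\<close>. The factor is the inverse of the weight at
  the index of the operator.\<close>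

lemma sigma_nabla:
  assumes "\<epsilon> \<in> C" "i \<noteq> j"
  shows "\<sigma> \<epsilon> i j (nabla i u) = frac_scale \<iota> (inverse \<epsilon>) (nabla j (\<sigma> \<epsilon> i j u))"
    and "\<sigma> \<epsilon> i j (nabla j u) = frac_scale \<iota> (- \<epsilon>) (nabla i (\<sigma> \<epsilon> i j u))"
    and "k \<noteq> i \<Longrightarrow> k \<noteq> j \<Longrightarrow> \<sigma> \<epsilon> i j (nabla k u) = nabla k (\<sigma> \<epsilon> i j u)"
proof -
  let ?w = "\<lambda>l. if l = i then \<epsilon> else if l = j then - inverse \<epsilon> else 1"
  let ?\<pi> = "\<lambda>l. if l = i then j else if l = j then i else l"
  have w: "?w l \<in> C" for l using assms(1) C_closed by simp
  have "inj ?\<pi>" using assms(2) by (auto simp: inj_def)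
  note s = skew_sigma[OF C_nonzero[OF assms(1)] assms(2)]
  have "skew_sigma \<epsilon> i j (skew_var l) = skew_scale (?w l) (skew_var (?\<pi> l))" for l
    using s(2)[of l] by simp
  note eq = nabla_equivariant[OF s(1) this \<open>inj ?\<pi>\<close> w]
  show "\<sigma> \<epsilon> i j (nabla i u) = frac_scale \<iota> (inverse \<epsilon>) (nabla j (\<sigma> \<epsilon> i j u))"
    using eq[of i u] by simp
  show "\<sigma> \<epsilon> i j (nabla j u) = frac_scale \<iota> (- \<epsilon>) (nabla i (\<sigma> \<epsilon> i j u))"
    using eq[of j u] assms(2) by simp
  show "\<sigma> \<epsilon> i j (nabla k u) = nabla k (\<sigma> \<epsilon> i j u)" if "k \<noteq> i" "k \<noteq> j"
    using eq[of k u] that by simp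
qed

section \<open>Commutators of the brackets with the Dunkl operators\<close>

lemma skew_sigma_swap:
  assumes "\<epsilon> \<noteq> 0" "i \<noteq> j"
  shows "skew_sigma (- inverse \<epsilon>) j i = skew_sigma \<epsilon> i j"
  unfolding skew_sigma_def
  by (rule arg_cong[where f = skew_aut_of]) (use assms in auto)

text \<open>Reindexing by \<open>- inverse \<epsilon>\<close> expresses this bracket through the
  \<open>\<sigma> \<epsilon> i j\<close> that also occur in \<open>nabla_bracket i i\<close>, so
  that the two can cancel.\<close>

lemma nabla_bracket_swap:
  assumes "i \<noteq> j"
  shows "nabla_bracket j i u = frac_scale \<iota> (c 1) (\<Sum>\<epsilon>\<in>C. frac_scale \<iota> (- \<epsilon>) (\<sigma> \<epsilon> i j u))"
proof -
  have "(\<Sum>\<epsilon>\<in>C. frac_scale \<iota> (inverse \<epsilon>) (\<sigma> \<epsilon> j i u)) =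
      (\<Sum>\<epsilon>\<in>C. frac_scale \<iota> (- \<epsilon>) (\<sigma> \<epsilon> i j u))"
    by (rule sum.reindex_bij_witness[where i = "\<lambda>\<epsilon>. - inverse \<epsilon>" and j = "\<lambda>\<epsilon>. - inverse \<epsilon>"])
       (use assms C_closed C_nonzero skew_sigma_swap[of _ j i] in auto)
  then show ?thesis using assms by (simp add: nabla_bracket_def)
qed

lemma nabla_bracket_off_diagonal:
  assumes "i \<noteq> j" "k \<noteq> i" "k \<noteq> j"
  shows "nabla i (nabla_bracket j k u) = nabla_bracket j k (nabla i u)"
  using assms sigma_nabla(3)[of _ j k i]
  by (simp add: nabla_bracket_def nabla_linear nabla_sum cong: sum.cong_simp)

text \<open>The left side is the remainder when \<open>x_i\<close> passes the anticommutator of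
  \<open>nabla i\<close> and \<open>nabla j\<close>.\<close>

lemma nabla_bracket_diagonal:
  assumes "i \<noteq> j"
  shows "nabla j (nabla_bracket i i u) - nabla_bracket i i (nabla j u) +
    (nabla i (nabla_bracket j i u) + nabla_bracket j i (nabla i u)) = 0"
proof -
  have t: "nabla j (\<tau> \<epsilon> i u) = \<tau> \<epsilon> i (nabla j u)" if "\<epsilon> \<in> C' - {1}" for \<epsilon>
    using t_nabla[of \<epsilon> i j u] that C'_subset assms by auto
  \<comment> \<open>For \<open>l \<noteq> j\<close> the reflection commutes with
    \<open>nabla j\<close>; for \<open>l = j\<close> it turns \<open>nabla j\<close> into
    \<open>- \<epsilon>\<close> times \<open>nabla i\<close>.\<close>
  have s: "nabla j (\<Sum>\<epsilon>\<in>C. \<sigma> \<epsilon> i l u) - (\<Sum>\<epsilon>\<in>C. \<sigma> \<epsilon> i l (nabla j u)) =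
      (if l = j then \<Sum>\<epsilon>\<in>C. nabla j (\<sigma> \<epsilon> i j u) + frac_scale \<iota> \<epsilon> (nabla i (\<sigma> \<epsilon> i j u)) else 0)"
    if "l \<in> UNIV - {i}" for l
    using assms that sigma_nabla(2)[of _ i j u] sigma_nabla(3)[of _ i l j u]
    by (simp add: nabla_sum sum.distrib sum_negf cong: sum.cong_simp)
  have "nabla j (nabla_bracket i i u) - nabla_bracket i i (nabla j u) =
      frac_scale \<iota> (c 1) (\<Sum>l\<in>UNIV - {i}.
        nabla j (\<Sum>\<epsilon>\<in>C. \<sigma> \<epsilon> i l u) - (\<Sum>\<epsilon>\<in>C. \<sigma> \<epsilon> i l (nabla j u)))"
    unfolding sum_subtractf frac.scale_right_diff_distrib
    by (simp add: nabla_bracket_def nabla_linear nabla_sum t cong: sum.cong_simp)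
  also have "\<dots> = frac_scale \<iota> (c 1)
      (\<Sum>\<epsilon>\<in>C. nabla j (\<sigma> \<epsilon> i j u) + frac_scale \<iota> \<epsilon> (nabla i (\<sigma> \<epsilon> i j u)))"
    using assms by (simp add: s cong: sum.cong_simp)
  finally have 1: "nabla j (nabla_bracket i i u) - nabla_bracket i i (nabla j u) = \<dots>" .
  \<comment> \<open>In the second summand the weight \<open>- \<epsilon>\<close> meets the factor
    \<open>inverse \<epsilon>\<close> from \<open>sigma_nabla\<close>, leaving
    \<open>- nabla j\<close>.\<close>
  have 2: "nabla i (nabla_bracket j i u) + nabla_bracket j i (nabla i u) =
      - frac_scale \<iota> (c 1)
        (\<Sum>\<epsilon>\<in>C. nabla j (\<sigma> \<epsilon> i j u) + frac_scale \<iota> \<epsilon> (nabla i (\<sigma> \<epsilon> i j u)))"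
    using assms
    by (simp add: nabla_bracket_swap sigma_nabla(1) nabla_linear nabla_diff nabla_sum sum.distrib sum_negf
        frac.scale_right_distrib C_nonzero cong: sum.cong_simp)
  show ?thesis unfolding 1 2 by simp
qed

lemma nabla_anticommute:
  assumes "i \<noteq> j"
  shows "nabla i (nabla j u) + nabla j (nabla i u) = 0"
proof (rule twisted_linear_eq_0[where T = "\<lambda>u. nabla i (nabla j u) + nabla j (nabla i u)"
      and f = "skew_gamma i \<circ> skew_gamma j"])
  show "skew_automorphism (skew_gamma i \<circ> skew_gamma j)"
    by (intro skew_automorphism_comp skew_gamma)
  show "nabla i (nabla j 1) + nabla j (nabla i 1) = 0"
    using nabla_linear(2)[of _ 0 0] by (simp add: nabla_linear(3))
  show "Vector_Spaces.linear (frac_scale \<iota>) (frac_scale \<iota>)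
      (\<lambda>u. nabla i (nabla j u) + nabla j (nabla i u))"
    by (simp add: frac_linear_iff nabla_linear frac.scale_right_distrib add_ac)
  fix k u
  let ?x = "\<iota> (skew_var k)"
  have gneg: "skew_gamma l (- p) = - skew_gamma l p" for l p
    using skew_gamma(1)[of l] by (auto simp: skew_automorphism_def intro: skew_linear_uminus)
  note expand = nabla_var nabla_linear nabla_diff skew_gamma gneg embed_uminus
  consider "k = i" | "k = j" | "k \<noteq> i" "k \<noteq> j" by blast
  then show "nabla i (nabla j (?x * u)) + nabla j (nabla i (?x * u)) =
      \<iota> ((skew_gamma i \<circ> skew_gamma j) (skew_var k)) * (nabla i (nabla j u) + nabla j (nabla i u))"
  proof cases
    \<comment> \<open>Exactly one of the two twists negates \<open>x_i\<close>, so the remainder is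
      a commutator with one bracket plus an anticommutator with the other.\<close>
    case 1
    with nabla_bracket_diagonal[OF assms, of u] assms show ?thesis
      by (simp add: expand ring_distribs) (simp add: algebra_simps eq_neg_iff_add_eq_0)
  next
    case 2
    with nabla_bracket_diagonal[OF assms[symmetric], of u] assms show ?thesis
      by (simp add: expand ring_distribs) (simp add: algebra_simps eq_neg_iff_add_eq_0)
  next
    \<comment> \<open>Both twists negate \<open>x_k\<close>, so the remainder is a sum of two
      commutators, each of them zero.\<close>
    case 3
    with nabla_bracket_off_diagonal[of i j k u] nabla_bracket_off_diagonal[of j i k u] assms
    show ?thesis by (simp add: expand ring_distribs)
  qed
qed

end

theorem theorem0p1:
  fixes \<iota> :: "'n::{finite,linorder} skew_poly \<Rightarrow> 'k::division_ring"
    and C C' :: "complex set" and c :: "complex \<Rightarrow> complex"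
  assumes "skew_field_of_fractions \<iota>"
    and "subgroup C complex_units" and "finite C" and "- 1 \<in> C"
    and "subgroup C' complex_units" and "finite C'" and "C' \<subseteq> C"
  shows "(\<forall>i. braided_nabla \<iota> C C' c i ` range \<iota> \<subseteq> range \<iota>) \<and>
    (\<forall>i j. i \<noteq> j \<longrightarrow> (\<forall>u. braided_nabla \<iota> C C' c i (braided_nabla \<iota> C C' c j u) +
      braided_nabla \<iota> C C' c j (braided_nabla \<iota> C C' c i u) = 0))"
proof -
  interpret braided_dunkl \<iota> C C' c
    by (intro braided_dunkl.intro skew_poly_fractions.intro braided_dunkl_axioms.intro assms)
  show ?thesis using nabla_preserves nabla_anticommute by blast
qed

end
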